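(* Let $D_1(w_0)=\{z\in\mathbb{C} : |z-w_0|<1\}$, and consider the two polydiscs $$P_1^2=\{(z_1,z_2)\in\mathbb{C}^2 : z_1\in D_1(0),\ |z_2|<1\},\qquad P_2^2=\{(z_1,z_2)\in\mathbb{C}^2 : z_1\in D_1(1),\ |z_2|<1\},$$ and their intersection $$\mathcal{P}=P_1^2\cap P_2^2=\{(z_1,z_2)\in\mathbb{C}^2 : z_1\in D_1(0)\cap D_1(1),\ |z_2|<1\}.$$ Then the Bergman projection $\mathcal{B}_{\mathcal{P}}$ of $\mathcal{P}$ is not exactly regular. In particular, there exists a function $f\in C^\infty(\overline{\mathcal{P}})$ such that $\mathcal{B}_{\mathcal{P}}f\notin C^\infty(\overline{\mathcal{P}})$ and $\mathcal{B}_{\mathcal{P}}f\notin W^k(\mathcal{P})$ for all sufficiently large $k\in\mathbb{N}$.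
   Context: For a bounded domain $\Omega\subset\mathbb{C}^n$, the Bergman projection $\mathcal{B}_\Omega$ is the orthogonal projection of $L^2(\Omega)$ onto the closed subspace of square-integrable holomorphic functions. $W^k(\Omega)$ denotes the $L^2$-Sobolev space of order $k$ on $\Omega$. The Bergman projection $\mathcal{B}_\Omega$ is called exactly regular if it maps $W^k(\Omega)$ to $W^k(\Omega)$ for all integers $k\ge 0$. $C^\infty(\overline{\Omega})$ denotes the functions smooth up to the closure of $\Omega$. *)

theory Defs
  imports "HOL-Analysis.Analysis"
begin

text \<open>
  Elements of function spaces over an open set \<open>\<Omega>\<close> are represented by total functions of which
  only the values on \<open>\<Omega>\<close> matter. Complex 2-space is the type \<open>complex \<times> complex\<close>; its \<open>Basis\<close>
  consists of the four real coordinate directions.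
\<close>

text \<open>
  Multi-indices are encoded as lists of basis vectors: the derivative of order \<open>\<alpha>\<close> is
  \<open>iter_partial bs\<close> for any list \<open>bs\<close> in which each basis vector \<open>b\<close> occurs \<open>\<alpha> b\<close> times, and
  \<open>length bs\<close> is the order of \<open>\<alpha>\<close>. All orders of differentiation are listed,
  but they agree for smooth functions.
\<close>

fun iter_partial ::
  "'a::euclidean_space list \<Rightarrow> ('a \<Rightarrow> 'b::real_normed_vector) \<Rightarrow> 'a \<Rightarrow> 'b" where
  "iter_partial [] f = f"
| "iter_partial (b # bs) f = (\<lambda>x. frechet_derivative (iter_partial bs f) (at x) b)"

text \<open>Smoothness is only meant to be used for open \<open>\<Omega>\<close>.\<close>

definition smooth_on :: "'a::euclidean_space set \<Rightarrow> ('a \<Rightarrow> 'b::real_normed_vector) \<Rightarrow> bool" where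
  "smooth_on \<Omega> f \<longleftrightarrow>
     (\<forall>bs \<in> lists Basis. \<forall>x \<in> \<Omega>. iter_partial bs f differentiable (at x))"

definition smooth_upto_closure :: "'a::euclidean_space set \<Rightarrow> ('a \<Rightarrow> complex) set" where
  "smooth_upto_closure \<Omega> = {f. smooth_on \<Omega> f \<and>
     (\<forall>bs \<in> lists Basis. \<exists>g. continuous_on (closure \<Omega>) g \<and>
        (\<forall>x \<in> \<Omega>. g x = iter_partial bs f x))}"

definition test_functions :: "'a::euclidean_space set \<Rightarrow> ('a \<Rightarrow> real) set" where
  "test_functions \<Omega> = {\<phi>. smooth_on UNIV \<phi> \<and>
     compact (closure {x. \<phi> x \<noteq> 0}) \<and> closure {x. \<phi> x \<noteq> 0} \<subseteq> \<Omega>}"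

definition L2 :: "'a::euclidean_space set \<Rightarrow> ('a \<Rightarrow> complex) set" where
  "L2 \<Omega> = {f. f \<in> borel_measurable (lebesgue_on \<Omega>) \<and>
     integrable (lebesgue_on \<Omega>) (\<lambda>x. (cmod (f x))\<^sup>2)}"

definition L2_inner ::
  "'a::euclidean_space set \<Rightarrow> ('a \<Rightarrow> complex) \<Rightarrow> ('a \<Rightarrow> complex) \<Rightarrow> complex" where
  "L2_inner \<Omega> f g = (LINT x|lebesgue_on \<Omega>. f x * cnj (g x))"

definition weak_derivative ::
  "'a::euclidean_space set \<Rightarrow> 'a list \<Rightarrow> ('a \<Rightarrow> complex) \<Rightarrow> ('a \<Rightarrow> complex) \<Rightarrow> bool" where
  "weak_derivative \<Omega> bs f g \<longleftrightarrow> (\<forall>\<phi> \<in> test_functions \<Omega>.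
     (LINT x|lebesgue_on \<Omega>. iter_partial bs \<phi> x *\<^sub>R f x) =
     (-1) ^ length bs * (LINT x|lebesgue_on \<Omega>. \<phi> x *\<^sub>R g x))"

definition sobolev :: "nat \<Rightarrow> 'a::euclidean_space set \<Rightarrow> ('a \<Rightarrow> complex) set" where
  "sobolev k \<Omega> = {f \<in> L2 \<Omega>. \<forall>bs \<in> lists Basis. length bs \<le> k \<longrightarrow>
     (\<exists>g \<in> L2 \<Omega>. weak_derivative \<Omega> bs f g)}"

lemma sobolev_0: "sobolev 0 \<Omega> = L2 \<Omega>"
  by (auto simp: sobolev_def weak_derivative_def)

definition holomorphic2_on :: "(complex \<times> complex \<Rightarrow> complex) \<Rightarrow> (complex \<times> complex) set \<Rightarrow> bool" where
  "holomorphic2_on f \<Omega> \<longleftrightarrow> (\<forall>z \<in> \<Omega>. \<exists>a b.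
     (f has_derivative (\<lambda>h. a * fst h + b * snd h)) (at z))"

definition bergman_space :: "(complex \<times> complex) set \<Rightarrow> (complex \<times> complex \<Rightarrow> complex) set" where
  "bergman_space \<Omega> = {f \<in> L2 \<Omega>. holomorphic2_on f \<Omega>}"

text \<open>
  The orthogonal projection of \<open>f\<close> is the \<open>h\<close> in the Bergman space for which \<open>f - h\<close> is orthogonal
  to the Bergman space. A holomorphic representative is determined only on \<open>\<Omega>\<close>; it is set to 0
  elsewhere so that it is unique as a total function.
\<close>

definition bergman_projection ::
  "(complex \<times> complex) set \<Rightarrow> (complex \<times> complex \<Rightarrow> complex) \<Rightarrow> complex \<times> complex \<Rightarrow> complex" where
  "bergman_projection \<Omega> f = (THE h. h \<in> bergman_space \<Omega> \<and> (\<forall>z. z \<notin> \<Omega> \<longrightarrow> h z = 0) \<and>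
     (\<forall>g \<in> bergman_space \<Omega>. L2_inner \<Omega> (\<lambda>z. f z - h z) g = 0))"

definition exactly_regular :: "(complex \<times> complex) set \<Rightarrow> bool" where
  "exactly_regular \<Omega> \<longleftrightarrow>
     (\<forall>k. \<forall>f \<in> sobolev k \<Omega>. bergman_projection \<Omega> f \<in> sobolev k \<Omega>)"

definition polydisc_at :: "complex \<Rightarrow> (complex \<times> complex) set" where
  "polydisc_at w\<^sub>0 = {(z\<^sub>1, z\<^sub>2). z\<^sub>1 \<in> ball w\<^sub>0 1 \<and> cmod z\<^sub>2 < 1}"

definition polydisc_inter :: "(complex \<times> complex) set" where
  "polydisc_inter = polydisc_at 0 \<inter> polydisc_at 1"

lemma polydisc_inter_eq:
  "polydisc_inter = {(z\<^sub>1, z\<^sub>2). z\<^sub>1 \<in> ball 0 1 \<inter> ball 1 1 \<and> cmod z\<^sub>2 < 1}"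
  by (auto simp: polydisc_inter_def polydisc_at_def)

end

theory Submission
  imports Defs "HOL-Complex_Analysis.Cauchy_Integral_Formula"
begin

text \<open>
  The lens \<open>L = D\<^sub>1(0) \<inter> D\<^sub>1(1)\<close> has corners of angle \<open>2\<pi>/3\<close>, so a conformal map \<open>\<phi>\<close> of \<open>L\<close> onto
  the unit disc behaves like \<open>\<zeta> \<mapsto> \<zeta>\<^bsup>3/2\<^esup>\<close> at a corner and \<open>\<phi>'\<close> like \<open>\<zeta>\<^bsup>1/2\<^esup>\<close>. Its third
  derivative grows like \<open>\<zeta>\<^bsup>-5/2\<^esup>\<close>, which is not square integrable over the product of \<open>L\<close> with a disc.
  But \<open>\<phi>'\<close> is the Bergman projection of the smooth, compactly supported function \<open>\<eta>(\<bar>\<phi>\<bar>\<^sup>2) \<phi>'\<close>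
  whenever \<open>\<eta> = 1 + X'\<close> with \<open>X = 0\<close> near \<open>0\<close> and \<open>X s = 1 - s\<close> near \<open>1\<close>: the conjugate of
  the difference is \<open>X'(\<bar>\<phi>\<bar>\<^sup>2) cnj \<phi>'\<close>, the \<open>z\<^sub>1\<close>-bar-derivative of \<open>X(\<bar>\<phi>\<bar>\<^sup>2) / \<phi>\<close>, which vanishes on
  the boundary, so Stokes' theorem makes it orthogonal to every holomorphic \<open>g\<close>.
\<close>

section \<open>Functions of class \<open>C\<^sup>n\<close>\<close>

text \<open>The identity is therefore proved with cutoffs in \<open>|\<phi>|^2\<close> and in
  \<open>|z2|^2\<close>, which are then removed by dominated convergence. A cutoff at scale 1/k
  costs a factor k in its derivative; this is absorbed because \<open>X s\<close> is of size 1 - s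
  near 1. The cutoff in the second variable costs nothing, since only the first variable is
  differentiated. The condition that \<open>X\<close> vanish near 0 removes the poles of
  \<open>1/\<phi>\<close> at zeros of \<open>\<phi>\<close>. The order 3 comes from working with one
  ball at a time. The second derivative of \<open>\<phi>'\<close>, of size t^(-3/2) at distance t
  from the corner, is already not square integrable, but a ball in R^4 of radius comparable to t
  carries only about t^(-3) t^4 of its square integral, which tends to 0. At order 3 a single ball
  carries about t^(-5) t^4 = 1/t, so letting one ball shrink to the corner gives the
  contradiction.\<close>

fun times_differentiable_on ::
  "nat \<Rightarrow> 'a::euclidean_space set \<Rightarrow> ('a \<Rightarrow> 'b::real_normed_vector) \<Rightarrow> bool" where
  "times_differentiable_on 0 \<Omega> f \<longleftrightarrow> True"
| "times_differentiable_on (Suc n) \<Omega> f \<longleftrightarrow>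
     (\<exists>f'. (\<forall>x\<in>\<Omega>. (f has_derivative f' x) (at x)) \<and>
           (\<forall>b\<in>Basis. times_differentiable_on n \<Omega> (\<lambda>x. f' x b)))"

declare times_differentiable_on.simps(2) [simp del]

lemma times_differentiable_on_SucI:
  assumes "\<And>x. x \<in> \<Omega> \<Longrightarrow> (f has_derivative f' x) (at x)"
    and "\<And>b. b \<in> Basis \<Longrightarrow> times_differentiable_on n \<Omega> (\<lambda>x. f' x b)"
  shows "times_differentiable_on (Suc n) \<Omega> f"
  using assms by (auto simp: times_differentiable_on.simps(2))

lemma times_differentiable_on_SucE:
  assumes "times_differentiable_on (Suc n) \<Omega> f"
  obtains f' where "\<forall>x\<in>\<Omega>. (f has_derivative f' x) (at x)"
    "\<forall>b\<in>Basis. times_differentiable_on n \<Omega> (\<lambda>x. f' x b)"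
  using assms by (auto simp: times_differentiable_on.simps(2))

lemma times_differentiable_on_imp_differentiable:
  "times_differentiable_on (Suc n) \<Omega> f \<Longrightarrow> x \<in> \<Omega> \<Longrightarrow> f differentiable (at x)"
  by (auto simp: times_differentiable_on.simps(2) differentiable_def)

lemma times_differentiable_on_cong:
  assumes "open \<Omega>" "\<And>x. x \<in> \<Omega> \<Longrightarrow> f x = g x" "times_differentiable_on n \<Omega> f"
  shows "times_differentiable_on n \<Omega> g"
proof (cases n)
  case (Suc m)
  obtain f' where f': "\<And>x. x \<in> \<Omega> \<Longrightarrow> (f has_derivative f' x) (at x)"
    "\<And>b. b \<in> Basis \<Longrightarrow> times_differentiable_on m \<Omega> (\<lambda>x. f' x b)"
    by (rule times_differentiable_on_SucE[OF assms(3)[unfolded Suc]]) (use that in blast)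
  have "(g has_derivative f' x) (at x)" if "x \<in> \<Omega>" for x
    using has_derivative_transform_within_open[OF f'(1)[OF that] assms(1) that] assms(2) by blast
  then show ?thesis
    using f'(2) Suc by (auto intro: times_differentiable_on_SucI)
qed auto

lemma times_differentiable_on_SucD:
  "times_differentiable_on (Suc n) \<Omega> f \<Longrightarrow> times_differentiable_on n \<Omega> f"
proof (induction n arbitrary: f)
  case (Suc n)
  obtain f' where f': "\<And>x. x \<in> \<Omega> \<Longrightarrow> (f has_derivative f' x) (at x)"
    "\<And>b. b \<in> Basis \<Longrightarrow> times_differentiable_on (Suc n) \<Omega> (\<lambda>x. f' x b)"
    by (rule times_differentiable_on_SucE[OF Suc.prems(1)]) (use that in blast)
  show ?case
    by (rule times_differentiable_on_SucI[OF f'(1) Suc.IH[OF f'(2)]])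
qed auto

lemma times_differentiable_on_subset:
  "times_differentiable_on n \<Omega> f \<Longrightarrow> \<Omega>' \<subseteq> \<Omega> \<Longrightarrow> times_differentiable_on n \<Omega>' f"
proof (induction n arbitrary: f)
  case (Suc n)
  obtain f' where f': "\<And>x. x \<in> \<Omega> \<Longrightarrow> (f has_derivative f' x) (at x)"
    "\<And>b. b \<in> Basis \<Longrightarrow> times_differentiable_on n \<Omega> (\<lambda>x. f' x b)"
    by (rule times_differentiable_on_SucE[OF Suc.prems(1)]) (use that in blast)
  show ?case
    using f' Suc by (intro times_differentiable_on_SucI[of _ _ f']) auto
qed auto

lemma times_differentiable_on_const: "times_differentiable_on n \<Omega> (\<lambda>x. c)"
  by (induction n arbitrary: c) (auto intro!: times_differentiable_on_SucI[where f' = "\<lambda>_ _. 0"])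

lemma times_differentiable_on_bounded_linear:
  assumes "bounded_linear f"
  shows "times_differentiable_on n \<Omega> f"
  using assms times_differentiable_on_const
  by (cases n)
    (auto intro!: times_differentiable_on_SucI[where f' = "\<lambda>_. f"] bounded_linear_imp_has_derivative)

lemma times_differentiable_on_add:
  assumes "times_differentiable_on n \<Omega> f" "times_differentiable_on n \<Omega> g"
  shows "times_differentiable_on n \<Omega> (\<lambda>x. f x + g x)"
  using assms
proof (induction n arbitrary: f g)
  case (Suc n)
  obtain f' where f': "\<And>x. x \<in> \<Omega> \<Longrightarrow> (f has_derivative f' x) (at x)"
    "\<And>b. b \<in> Basis \<Longrightarrow> times_differentiable_on n \<Omega> (\<lambda>x. f' x b)"
    by (rule times_differentiable_on_SucE[OF Suc.prems(1)]) (use that in blast)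
  obtain g' where g': "\<And>x. x \<in> \<Omega> \<Longrightarrow> (g has_derivative g' x) (at x)"
    "\<And>b. b \<in> Basis \<Longrightarrow> times_differentiable_on n \<Omega> (\<lambda>x. g' x b)"
    by (rule times_differentiable_on_SucE[OF Suc.prems(2)]) (use that in blast)
  show ?case
    by (rule times_differentiable_on_SucI, rule has_derivative_add[OF f'(1) g'(1)])
      (use f'(2) g'(2) Suc.IH in auto)
qed auto

lemma times_differentiable_on_compose_linear:
  assumes "bounded_linear l" "times_differentiable_on n \<Omega> f"
  shows "times_differentiable_on n \<Omega> (\<lambda>x. l (f x))"
  using assms(2)
proof (induction n arbitrary: f)
  case (Suc n)
  obtain f' where f': "\<And>x. x \<in> \<Omega> \<Longrightarrow> (f has_derivative f' x) (at x)"
    "\<And>b. b \<in> Basis \<Longrightarrow> times_differentiable_on n \<Omega> (\<lambda>x. f' x b)"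
    by (rule times_differentiable_on_SucE[OF Suc.prems(1)]) (use that in blast)
  show ?case
    by (rule times_differentiable_on_SucI, rule bounded_linear.has_derivative[OF assms(1) f'(1)])
      (use f'(2) Suc.IH in auto)
qed auto

lemma times_differentiable_on_bilinear:
  assumes "bounded_bilinear pr" "times_differentiable_on n \<Omega> f" "times_differentiable_on n \<Omega> g"
  shows "times_differentiable_on n \<Omega> (\<lambda>x. pr (f x) (g x))"
  using assms(2,3)
proof (induction n arbitrary: f g)
  case (Suc n)
  obtain f' where f': "\<And>x. x \<in> \<Omega> \<Longrightarrow> (f has_derivative f' x) (at x)"
    "\<And>b. b \<in> Basis \<Longrightarrow> times_differentiable_on n \<Omega> (\<lambda>x. f' x b)"
    by (rule times_differentiable_on_SucE[OF Suc.prems(1)]) (use that in blast)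
  obtain g' where g': "\<And>x. x \<in> \<Omega> \<Longrightarrow> (g has_derivative g' x) (at x)"
    "\<And>b. b \<in> Basis \<Longrightarrow> times_differentiable_on n \<Omega> (\<lambda>x. g' x b)"
    by (rule times_differentiable_on_SucE[OF Suc.prems(2)]) (use that in blast)
  show ?case
    by (rule times_differentiable_on_SucI, rule bounded_bilinear.FDERIV[OF assms(1) f'(1) g'(1)])
      (assumption | intro times_differentiable_on_add Suc.IH f'(2) g'(2)
        times_differentiable_on_SucD[OF Suc.prems(1)] times_differentiable_on_SucD[OF Suc.prems(2)])+
qed auto

text \<open>The derivative of \<open>r\<close> at a real point is multiplication by its value at 1,
  so the composite differentiates to a product involving \<open>r'\<close> composed with
  \<open>g\<close>. The induction ranges over all \<open>r\<close> because \<open>r'\<close> takes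
  its place.\<close>

lemma times_differentiable_on_compose_real:
  fixes g :: "'a::euclidean_space \<Rightarrow> real" and r :: "real \<Rightarrow> real"
  assumes "times_differentiable_on n V r" "times_differentiable_on n \<Omega> g"
    and "\<And>x. x \<in> \<Omega> \<Longrightarrow> g x \<in> V"
  shows "times_differentiable_on n \<Omega> (\<lambda>x. r (g x))"
  using assms(1,2)
proof (induction n arbitrary: r)
  case (Suc n)
  obtain g' where g': "\<And>x. x \<in> \<Omega> \<Longrightarrow> (g has_derivative g' x) (at x)"
    "\<And>b. b \<in> Basis \<Longrightarrow> times_differentiable_on n \<Omega> (\<lambda>x. g' x b)"
    by (rule times_differentiable_on_SucE[OF Suc.prems(2)]) (use that in blast)
  obtain r' where r': "\<And>x. x \<in> V \<Longrightarrow> (r has_derivative r' x) (at x)"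
    "times_differentiable_on n V (\<lambda>x. r' x 1)"
    by (rule times_differentiable_on_SucE[OF Suc.prems(1)]) (use that in auto)
  have eq: "r' (g x) (g' x b) = g' x b * r' (g x) 1" if "x \<in> \<Omega>" for x b
    using linear_cmul[OF has_derivative_linear[OF r'(1)[OF assms(3)[OF that]]], of "g' x b" 1] by simp
  have "((\<lambda>x. r (g x)) has_derivative (\<lambda>b. g' x b * r' (g x) 1)) (at x)" if "x \<in> \<Omega>" for x
    using has_derivative_compose[OF g'(1)[OF that] r'(1)[OF assms(3)[OF that]]] eq[OF that]
    by simp
  then show ?case
    by (rule times_differentiable_on_SucI)
      (assumption | intro times_differentiable_on_bilinear[OF bounded_bilinear_mult] g'(2)
        Suc.IH[OF r'(2)] times_differentiable_on_SucD[OF Suc.prems(2)])+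
qed auto

text \<open>The derivatives witnessing the two hypotheses may differ off their sets, so they are
  glued through \<open>frechet_derivative\<close>, with which each agrees on its own set by
  uniqueness. This is how functions extended by zero become smooth on the whole space.\<close>

lemma times_differentiable_on_union:
  "times_differentiable_on n U f \<Longrightarrow> times_differentiable_on n V f \<Longrightarrow> open U \<Longrightarrow> open V \<Longrightarrow>
    times_differentiable_on n (U \<union> V) f"
proof (induction n arbitrary: f)
  case (Suc n)
  obtain f' where f': "\<And>x. x \<in> U \<Longrightarrow> (f has_derivative f' x) (at x)"
    "\<And>b. b \<in> Basis \<Longrightarrow> times_differentiable_on n U (\<lambda>x. f' x b)"
    by (rule times_differentiable_on_SucE[OF Suc.prems(1)]) (use that in blast)
  obtain f'' where f'': "\<And>x. x \<in> V \<Longrightarrow> (f has_derivative f'' x) (at x)"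
    "\<And>b. b \<in> Basis \<Longrightarrow> times_differentiable_on n V (\<lambda>x. f'' x b)"
    by (rule times_differentiable_on_SucE[OF Suc.prems(2)]) (use that in blast)
  let ?d = "\<lambda>x. frechet_derivative f (at x)"
  have d: "f' x = ?d x" if "x \<in> U" for x
    using f'(1)[OF that] by (rule frechet_derivative_at)
  have d': "f'' x = ?d x" if "x \<in> V" for x
    using f''(1)[OF that] by (rule frechet_derivative_at)
  show ?case
  proof (rule times_differentiable_on_SucI)
    show "(f has_derivative ?d x) (at x)" if "x \<in> U \<union> V" for x
      using that f'(1) f''(1) d d' by (metis Un_iff)
    show "times_differentiable_on n (U \<union> V) (\<lambda>x. ?d x b)" if b: "b \<in> Basis" for b
    proof (rule Suc.IH)
      show "times_differentiable_on n U (\<lambda>x. ?d x b)"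
        by (rule times_differentiable_on_cong[OF Suc.prems(3) _ f'(2)[OF b]]) (simp add: d)
      show "times_differentiable_on n V (\<lambda>x. ?d x b)"
        by (rule times_differentiable_on_cong[OF Suc.prems(4) _ f''(2)[OF b]]) (simp add: d')
    qed (use Suc.prems in auto)
  qed
qed auto

lemma times_differentiable_on_holomorphic:
  assumes "open S"
  shows "G holomorphic_on S \<Longrightarrow>
    times_differentiable_on n (S \<times> (UNIV :: complex set)) (\<lambda>z. G (fst z))"
proof (induction n arbitrary: G)
  case (Suc n)
  have "((\<lambda>z. G (fst z)) has_derivative (\<lambda>h. deriv G (fst z) * fst h)) (at z)"
    if "z \<in> S \<times> (UNIV :: complex set)" for z
  proof -
    have "(G has_field_derivative deriv G (fst z)) (at (fst z))"
      using that Suc.prems assms by (auto intro: holomorphic_derivI)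
    then have "(G has_derivative (*) (deriv G (fst z))) (at (fst z))"
      by (simp add: has_field_derivative_def)
    from has_derivative_compose[OF has_derivative_fst[OF has_derivative_ident] this]
    show ?thesis by simp
  qed
  then show ?case
    by (rule times_differentiable_on_SucI)
      (assumption | intro times_differentiable_on_bilinear[OF bounded_bilinear_mult]
        Suc.IH holomorphic_deriv Suc.prems assms times_differentiable_on_const)+
qed auto

text \<open>The bridge between the two notions of derivative: \<open>times_differentiable_on\<close>
  only asserts that some derivative exists, which makes the sum, product and chain rules plain
  inductions, and uniqueness of derivatives on an open set identifies it with the
  \<open>frechet_derivative\<close> inside \<open>iter_partial\<close>.\<close>

lemma times_differentiable_on_iter_partial:
  assumes "open \<Omega>" "bs \<in> lists Basis" "times_differentiable_on (n + length bs) \<Omega> f"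
  shows "times_differentiable_on n \<Omega> (iter_partial bs f)"
  using assms(2,3)
proof (induction bs arbitrary: n)
  case (Cons b bs)
  then have *: "times_differentiable_on (Suc n) \<Omega> (iter_partial bs f)"
    by auto
  obtain f' where f': "\<And>x. x \<in> \<Omega> \<Longrightarrow> (iter_partial bs f has_derivative f' x) (at x)"
    "\<And>b. b \<in> Basis \<Longrightarrow> times_differentiable_on n \<Omega> (\<lambda>x. f' x b)"
    by (rule times_differentiable_on_SucE[OF *]) (use that in blast)
  have "frechet_derivative (iter_partial bs f) (at x) = f' x" if "x \<in> \<Omega>" for x
    using frechet_derivative_at[OF f'(1)[OF that]] by simp
  then show ?case
    using Cons.hyps(1) times_differentiable_on_cong[OF assms(1) _ f'(2)] by simp
qed auto

lemma smooth_onI: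
  assumes "open \<Omega>" "\<And>n. times_differentiable_on n \<Omega> f"
  shows "smooth_on \<Omega> f"
  unfolding smooth_on_def
proof (intro ballI)
  fix bs x assume bs: "bs \<in> lists (Basis :: 'a set)" and x: "x \<in> \<Omega>"
  have "times_differentiable_on (Suc 0) \<Omega> (iter_partial bs f)"
    using times_differentiable_on_iter_partial[OF assms(1) bs assms(2)] .
  then show "iter_partial bs f differentiable at x"
    using x by (rule times_differentiable_on_imp_differentiable)
qed

section \<open>Flat functions and smooth cutoffs\<close>

text \<open>The powers of 1/x are included because this family is closed under differentiation up to
  linear combinations; smoothness of exp (-1/x) extended by 0 then follows by one induction for all
  \<open>k\<close> at once.\<close>

lemma flat_exp_has_derivative:
  fixes k :: nat and e :: "nat \<Rightarrow> real \<Rightarrow> real"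
  defines "e \<equiv> \<lambda>k (x::real). if 0 < x then (1/x)^k * exp (-(1/x)) else 0"
  shows "(e k has_real_derivative e (k+2) x - real k * e (k+1) x) (at x)"
proof -
  consider "x > 0" | "x < 0" | "x = 0" by linarith
  then show ?thesis
  proof cases
    case 1
    have "((\<lambda>x. (1/x)^k * exp (-(1/x))) has_real_derivative e (k+2) x - real k * e (k+1) x) (at x)"
      using 1 unfolding e_def
      by (auto intro!: derivative_eq_intros simp: field_simps power2_eq_square)
         (cases k; auto simp: field_simps power2_eq_square)
    then show ?thesis
      by (rule has_field_derivative_transform_within_open[of _ _ _ "{0<..}"])
        (use 1 in \<open>auto simp: e_def\<close>)
  next
    case 2
    have "((\<lambda>x. 0) has_real_derivative e (k+2) x - real k * e (k+1) x) (at x)"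
      using 2 by (auto simp: e_def)
    then show ?thesis
      by (rule has_field_derivative_transform_within_open[of _ _ _ "{..<0}"])
        (use 2 in \<open>auto simp: e_def\<close>)
  next
    case 3
    \<comment> \<open>With u = 1/x this is the right-hand difference quotient at 0; the left-hand
      one is identically 0.\<close>
    have "((\<lambda>u::real. u ^ Suc k / exp u) \<longlongrightarrow> 0) at_top" 
      by (rule tendsto_power_div_exp_0)
    then have "((\<lambda>x. (1/x) ^ Suc k / exp (1/x)) \<longlongrightarrow> 0) (at_right (0::real))"
      by (rule filterlim_compose) (simp add: filterlim_inverse_at_top_right flip: inverse_eq_divide)
    then have "((\<lambda>y. (e k y - e k 0) / (y - 0)) \<longlongrightarrow> 0) (at_right 0)"
      by (rule Lim_transform_eventually)
        (auto simp: e_def exp_minus eventually_at_right_field field_simps intro!: exI[of _ 1])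
    moreover have "((\<lambda>y. (e k y - e k 0) / (y - 0)) \<longlongrightarrow> 0) (at_left 0)"
      by (rule Lim_transform_eventually[OF tendsto_const])
        (auto simp: e_def eventually_at_left_field intro!: exI[of _ "-1"])
    ultimately show ?thesis
      using 3 by (simp add: has_field_derivative_iff filterlim_split_at) (simp add: e_def filterlim_split_at)
  qed
qed

lemma times_differentiable_on_real_SucI:
  fixes f :: "real \<Rightarrow> real"
  assumes "\<And>x. x \<in> \<Omega> \<Longrightarrow> (f has_real_derivative f' x) (at x)" "times_differentiable_on n \<Omega> f'"
  shows "times_differentiable_on (Suc n) \<Omega> f"
  by (rule times_differentiable_on_SucI[where f' = "\<lambda>x. (*) (f' x)"])
    (use assms in \<open>auto simp: has_field_derivative_def\<close>)

lemma times_differentiable_on_flat_exp: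
  "times_differentiable_on n UNIV (\<lambda>x::real. if 0 < x then (1/x)^k * exp (-(1/x)) else 0)"
proof (induction n arbitrary: k)
  case (Suc n)
  show ?case
  proof (rule times_differentiable_on_real_SucI[OF flat_exp_has_derivative])
    let ?e = "\<lambda>k (x::real). if 0 < x then (1/x)^k * exp (-(1/x)) else 0"
    have "times_differentiable_on n UNIV (\<lambda>x. ?e (k+2) x + (- real k) * ?e (k+1) x)"
      by (intro times_differentiable_on_add times_differentiable_on_const
        times_differentiable_on_bilinear[OF bounded_bilinear_mult] Suc.IH)
    then show "times_differentiable_on n UNIV (\<lambda>x. ?e (k+2) x - real k * ?e (k+1) x)"
      by simp
  qed
qed auto

lemma times_differentiable_on_inverse:
  "times_differentiable_on n {0<..} (inverse :: real \<Rightarrow> real)"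
proof (induction n)
  case (Suc n)
  show ?case
  proof (rule times_differentiable_on_real_SucI)
    show "(inverse has_real_derivative (-1) * (inverse x * inverse x)) (at x)"
      if "x \<in> {0<..}" for x :: real
      using DERIV_inverse[of x] that by (simp add: power2_eq_square)
    show "times_differentiable_on n {0<..} (\<lambda>x::real. (-1) * (inverse x * inverse x))"
      by (intro times_differentiable_on_const
        times_differentiable_on_bilinear[OF bounded_bilinear_mult] Suc.IH)
  qed
qed auto

text \<open>The classical quotient e(x - 1) / (e(x - 1) + e(2 - x)) of flat exponentials; its
  denominator is positive since x - 1 and 2 - x are never both nonpositive. The bound on
  \<open>x * \<rho>' x\<close> is invariant under rescaling: for the cutoff
  \<open>\<rho> (k * (1 - s))\<close> it controls (1 - s) times the derivative uniformly in
  k.\<close>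

lemma smooth_step_exists:
  obtains \<rho> \<rho>' :: "real \<Rightarrow> real" and C where
    "\<And>n. times_differentiable_on n UNIV \<rho>" "\<And>n. times_differentiable_on n UNIV \<rho>'"
    "\<And>x. (\<rho> has_real_derivative \<rho>' x) (at x)"
    "\<And>x. 0 \<le> \<rho> x" "\<And>x. \<rho> x \<le> 1"
    "\<And>x. x \<le> 1 \<Longrightarrow> \<rho> x = 0" "\<And>x. x \<ge> 2 \<Longrightarrow> \<rho> x = 1"
    "\<And>x. x \<le> 1 \<Longrightarrow> \<rho>' x = 0" "\<And>x. x \<ge> 2 \<Longrightarrow> \<rho>' x = 0"
    "\<And>x. \<bar>x * \<rho>' x\<bar> \<le> C"
proof -
  define e :: "real \<Rightarrow> real" where "e x = (if 0 < x then exp (-(1/x)) else 0)" for x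
  define \<rho> where "\<rho> x = e (x - 1) * inverse (e (x - 1) + e (2 - x))" for x
  have e: "times_differentiable_on n UNIV e" for n
    using times_differentiable_on_flat_exp[of n 0] by (simp add: e_def[abs_def] cong: if_cong)
  have e0: "e x \<ge> 0" for x by (simp add: e_def)
  have epos: "e (x - 1) + e (2 - x) > 0" for x
    by (cases "x > 1") (auto simp: e_def add_pos_nonneg)
  have shift: "times_differentiable_on n UNIV (\<lambda>x. x + c)" for n and c :: real
    by (intro times_differentiable_on_add times_differentiable_on_const times_differentiable_on_bounded_linear bounded_linear_ident)
  have lin: "times_differentiable_on n UNIV (\<lambda>x. c - x)" for n and c :: real
    using times_differentiable_on_add[OF times_differentiable_on_const[of n UNIV c]
        times_differentiable_on_bounded_linear[OF bounded_linear_minus[OF bounded_linear_ident]]]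
    by simp
  have e1: "times_differentiable_on n UNIV (\<lambda>x. e (x - 1))" for n
    using times_differentiable_on_compose_real[OF e shift[of n "-1"]] by simp
  have e2: "times_differentiable_on n UNIV (\<lambda>x. e (2 - x))" for n
    using times_differentiable_on_compose_real[OF e lin] by simp
  have s: "times_differentiable_on n UNIV \<rho>" for n
    unfolding \<rho>_def[abs_def]
    by (intro times_differentiable_on_bilinear[OF bounded_bilinear_mult] e1
        times_differentiable_on_compose_real[OF times_differentiable_on_inverse]
        times_differentiable_on_add e2) (simp add: epos)
  define \<rho>' where "\<rho>' x = deriv \<rho> x" for x
  have d: "(\<rho> has_real_derivative \<rho>' x) (at x)" for x
  proof -
    have "\<rho> differentiable at x"
      by (rule times_differentiable_on_imp_differentiable[OF s]) simp
    then show ?thesis unfolding \<rho>'_def using DERIV_deriv_iff_real_differentiable by blast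
  qed
  have s': "times_differentiable_on n UNIV \<rho>'" for n
  proof -
    obtain f' where f': "\<And>x. (\<rho> has_derivative f' x) (at x)"
      "times_differentiable_on n UNIV (\<lambda>x. f' x 1)"
      by (rule times_differentiable_on_SucE[OF s[of "Suc n"]]) (use that in auto)
    have "f' x 1 = \<rho>' x" for x
      using has_derivative_unique[OF f'(1) d[unfolded has_field_derivative_def]] by simp
    then show ?thesis using f'(2) by simp
  qed
  have z: "\<rho> x = 0" if "x \<le> 1" for x using that by (simp add: \<rho>_def e_def)
  have o: "\<rho> x = 1" if "x \<ge> 2" for x using that by (simp add: \<rho>_def e_def)
  have cont: "continuous_on UNIV \<rho>'"
    by (auto intro!: continuous_at_imp_continuous_on differentiable_imp_continuous_within
        times_differentiable_on_imp_differentiable[OF s'])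
  have z': "\<rho>' x = 0" if "x < 1" for x
  proof -
    have "(\<rho> has_real_derivative 0) (at x)"
      by (rule has_field_derivative_transform_within_open[of "\<lambda>_. 0" _ _ "{..<1}"]) (use that z in auto)
    then show ?thesis using d DERIV_unique by blast
  qed
  have o': "\<rho>' x = 0" if "x > 2" for x
  proof -
    have "(\<rho> has_real_derivative 0) (at x)"
      by (rule has_field_derivative_transform_within_open[of "\<lambda>_. 1" _ _ "{2<..}"]) (use that o in auto)
    then show ?thesis using d DERIV_unique by blast
  qed
  \<comment> \<open>The arguments on open half-lines miss the endpoints 1 and 2; continuity of
    \<open>\<rho>'\<close> supplies them.\<close>
  have cl: "closed {x. \<rho>' x = 0}"
    using cont by (intro closed_Collect_eq continuous_on_const)
  have z'': "\<rho>' x = 0" if "x \<le> 1" for x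
  proof -
    have "closure {..<1} \<subseteq> {x. \<rho>' x = 0}"
      by (rule closure_minimal[OF _ cl]) (use z' in auto)
    then show ?thesis using that by auto
  qed
  have o'': "\<rho>' x = 0" if "x \<ge> 2" for x
  proof -
    have "closure {2<..} \<subseteq> {x. \<rho>' x = 0}"
      by (rule closure_minimal[OF _ cl]) (use o' in auto)
    then show ?thesis using that by auto
  qed
  have "bounded (\<rho>' ` {1..2})"
    using cont by (intro compact_imp_bounded compact_continuous_image) (auto intro: continuous_on_subset)
  then obtain B where B: "\<And>x. x \<in> {1..2} \<Longrightarrow> \<bar>\<rho>' x\<bar> \<le> B" "B > 0"
    unfolding bounded_pos by (auto simp del: atLeastAtMost_iff)
  have C: "\<bar>x * \<rho>' x\<bar> \<le> 2 * B" for x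
  proof (cases "x \<in> {1..2}")
    case True
    then have "\<bar>x\<bar> * \<bar>\<rho>' x\<bar> \<le> 2 * B"
      using B(1)[OF True] by (intro mult_mono) auto
    then show ?thesis using B(1)[OF True] B(2) by (auto simp: abs_mult)
  qed (use z'' o'' B(2) in auto)
  have "0 \<le> \<rho> x" "\<rho> x \<le> 1" for x
    using epos[of x] e0[of "x-1"] e0[of "2-x"] by (auto simp: \<rho>_def field_simps)
  then show ?thesis using that[of \<rho> \<rho>' "2*B"] s s' d z o z'' o'' C by blast
qed

section \<open>Integration by parts and Sobolev spaces\<close>

text \<open>Difference quotients of \<open>F\<close> have integral 0 by translation invariance of
  Lebesgue measure, and they converge dominatedly to the derivative, the domination coming from the
  mean value inequality. A bound on the derivative in one direction is the form of hypothesis that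
  Cauchy's estimate can supply for a holomorphic factor.\<close>

lemma integral_directional_derivative_eq_0:
  fixes F :: "'a::euclidean_space \<Rightarrow> 'b::{banach,second_countable_topology}"
  assumes d: "\<And>x. (F has_derivative F' x) (at x)"
    and bd: "\<And>x. norm (F' x b) \<le> M"
    and supp: "\<And>x. norm x > R \<Longrightarrow> F x = 0"
  shows "integrable lborel (\<lambda>x. F' x b)" "(LINT x|lborel. F' x b) = 0"
proof -
  have cont: "continuous_on UNIV F"
    using d by (meson continuous_at_imp_continuous_on has_derivative_continuous)
  then have [measurable]: "F \<in> borel_measurable borel"
    by (rule borel_measurable_continuous_onI)
  define s where "s n x = real (Suc n) *\<^sub>R (F (x + inverse (real (Suc n)) *\<^sub>R b) - F x)" for n x
  have [measurable]: "s n \<in> borel_measurable borel" for n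
    unfolding s_def[abs_def] by measurable
  have line: "((\<lambda>t. F (x + t *\<^sub>R b)) has_derivative (\<lambda>t. t *\<^sub>R F' (x + u *\<^sub>R b) b)) (at u)" for x u
  proof -
    have "((\<lambda>t. F (x + t *\<^sub>R b)) has_derivative (\<lambda>t. F' (x + u *\<^sub>R b) (t *\<^sub>R b))) (at u)"
      by (rule has_derivative_compose[OF _ d]) (auto intro!: derivative_eq_intros)
    then show ?thesis
      by (simp add: linear_cmul[OF has_derivative_linear[OF d]])
  qed
  have lim: "(\<lambda>n. s n x) \<longlonglongrightarrow> F' x b" for x
  proof -
    have "((\<lambda>h. norm (F (x + h *\<^sub>R b) - F x - h *\<^sub>R F' x b) / norm h) \<longlongrightarrow> 0) (at 0)"
      using line[of x 0] by (simp add: has_derivative_at)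
    moreover have "filterlim (\<lambda>n. inverse (real (Suc n))) (at 0) sequentially"
      using LIMSEQ_inverse_real_of_nat by (simp add: filterlim_at)
    ultimately have "(\<lambda>n. norm (F (x + inverse (real (Suc n)) *\<^sub>R b) - F x -
        inverse (real (Suc n)) *\<^sub>R F' x b) / norm (inverse (real (Suc n)))) \<longlonglongrightarrow> 0"
      by (rule filterlim_compose)
    also have "(\<lambda>n. norm (F (x + inverse (real (Suc n)) *\<^sub>R b) - F x -
        inverse (real (Suc n)) *\<^sub>R F' x b) / norm (inverse (real (Suc n)))) = (\<lambda>n. norm (s n x - F' x b))"
    proof
      fix n
      let ?r = "real (Suc n)"
      have "s n x - F' x b = ?r *\<^sub>R (F (x + inverse ?r *\<^sub>R b) - F x - inverse ?r *\<^sub>R F' x b)"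
        unfolding s_def by (simp add: scaleR_diff_right del: of_nat_Suc)
      then show "norm (F (x + inverse ?r *\<^sub>R b) - F x - inverse ?r *\<^sub>R F' x b) / norm (inverse ?r) =
          norm (s n x - F' x b)"
        by (simp add: divide_inverse mult.commute del: of_nat_Suc)
    qed
    finally show ?thesis
      by (simp add: LIM_zero_iff tendsto_norm_zero_iff)
  qed
  \<comment> \<open>The step sizes are at most 1, so a difference quotient can be nonzero only
    within distance \<open>norm b\<close> of the support of \<open>F\<close>.\<close>
  define w where "w x = indicator (cball 0 (R + norm b)) x *\<^sub>R M" for x :: 'a
  have w: "integrable lborel w"
    unfolding w_def[abs_def] by (rule borel_integrable_compact) auto
  have bound: "norm (s n x) \<le> w x" for n x
  proof (cases "norm x > R + norm b")
    case True
    have "norm (inverse (real (Suc n)) *\<^sub>R b) \<le> 1 * norm b"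
      unfolding norm_scaleR by (intro mult_right_mono) (auto simp: field_simps)
    then have "norm (x + inverse (real (Suc n)) *\<^sub>R b) > R"
      using True norm_triangle_ineq4[of "x + inverse (real (Suc n)) *\<^sub>R b" "inverse (real (Suc n)) *\<^sub>R b"]
      by simp
    moreover have "norm x > R"
      using True norm_ge_zero[of b] by linarith
    ultimately have "s n x = 0"
      by (simp add: s_def supp del: of_nat_Suc)
    then show ?thesis
      using True by (simp add: w_def)
  next
    case False
    have on: "onorm (\<lambda>t. t *\<^sub>R F' (x + u *\<^sub>R b) b) \<le> M" for u :: real
    proof (rule onorm_le)
      show "norm (t *\<^sub>R F' (x + u *\<^sub>R b) b) \<le> M * norm t" for t
        using mult_right_mono[OF bd, of "norm t"] by (simp add: mult.commute)
    qed
    have "norm (F (x + inverse (real (Suc n)) *\<^sub>R b) - F (x + 0 *\<^sub>R b)) \<le> M * norm (inverse (real (Suc n)) - 0)"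
      by (rule differentiable_bound[of UNIV "\<lambda>t. F (x + t *\<^sub>R b)" "\<lambda>u t. t *\<^sub>R F' (x + u *\<^sub>R b) b"])
        (use line on in auto)
    then have "norm (s n x) \<le> M"
      by (simp add: s_def norm_scaleR divide_simps mult.commute del: of_nat_Suc scaleR_right_diff_distrib)
    then show ?thesis using False by (simp add: w_def)
  qed
  have intF: "integrable lborel F"
  proof -
    have "integrable lborel (\<lambda>x. indicator (cball 0 R) x *\<^sub>R F x)"
      by (rule borel_integrable_compact) (auto intro: continuous_on_subset[OF cont])
    also have "(\<lambda>x. indicator (cball 0 R) x *\<^sub>R F x) = F"
      using supp by (force simp: indicator_def)
    finally show ?thesis .
  qed
  have shift: "integrable lborel (\<lambda>x. F (x + c))" "(LINT x|lborel. F (x + c)) = (LINT x|lborel. F x)" for c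
  proof -
    have "integrable (distr lborel borel ((+) c)) F"
      using intF by (simp add: lborel_distr_plus)
    then show "integrable lborel (\<lambda>x. F (x + c))"
      by (subst (asm) integrable_distr_eq) (auto simp: add.commute)
    have "(LINT x|distr lborel borel ((+) c). F x) = (LINT x|lborel. F (c + x))"
      by (rule integral_distr) auto
    then show "(LINT x|lborel. F (x + c)) = (LINT x|lborel. F x)"
      by (simp add: lborel_distr_plus add.commute)
  qed
  have zero: "(LINT x|lborel. s n x) = 0" for n
    unfolding s_def using shift intF by simp
  have [measurable]: "(\<lambda>x. F' x b) \<in> borel_measurable borel"
    by (rule borel_measurable_LIMSEQ_metric[OF _ lim]) simp
  show "integrable lborel (\<lambda>x. F' x b)"
    by (rule integrable_dominated_convergence[where s = s and w = w]) (use w lim bound in auto)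
  have "(\<lambda>n. LINT x|lborel. s n x) \<longlonglongrightarrow> (LINT x|lborel. F' x b)"
    by (rule integral_dominated_convergence[where w = w]) (use w lim bound in auto)
  then show "(LINT x|lborel. F' x b) = 0"
    by (simp add: zero LIMSEQ_const_iff)
qed

text \<open>Extension by zero carries integrals over \<Omega> to \<open>lborel\<close> on the whole
  space, where translation invariance is available.\<close>

lemma lebesgue_on_integral_compact_support:
  fixes G :: "'a::euclidean_space \<Rightarrow> 'b::{banach,second_countable_topology}"
  assumes "open \<Omega>" "compact K" "K \<subseteq> \<Omega>" "continuous_on \<Omega> G" "\<And>x. x \<in> \<Omega> - K \<Longrightarrow> G x = 0"
  shows "integrable lborel (\<lambda>x. if x \<in> \<Omega> then G x else 0)"
    "integrable (lebesgue_on \<Omega>) G"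
    "(LINT x|lebesgue_on \<Omega>. G x) = (LINT x|lborel. (if x \<in> \<Omega> then G x else 0))"
proof -
  let ?F = "\<lambda>x. if x \<in> \<Omega> then G x else 0"
  have "integrable lborel (\<lambda>x. indicator K x *\<^sub>R G x)"
    using assms by (intro borel_integrable_compact) (auto intro: continuous_on_subset)
  also have "(\<lambda>x. indicator K x *\<^sub>R G x) = ?F"
    using assms(3,5) by (force simp: indicator_def)
  finally show i: "integrable lborel ?F" .
  then have m: "?F \<in> borel_measurable lborel" by simp
  have "integrable lebesgue ?F"
    using i integrable_completion[OF m] by simp
  then show "integrable (lebesgue_on \<Omega>) G"
    using assms(1) by (subst integrable_restrict_space) (simp_all add: indicator_scaleR_eq_if)
  show "(LINT x|lebesgue_on \<Omega>. G x) = (LINT x|lborel. ?F x)"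
    using assms(1) integral_completion[OF m] by (subst integral_restrict_space) (simp_all add: indicator_scaleR_eq_if)
qed

text \<open>The product of \<open>\<Phi>\<close> and \<open>f\<close>, extended by zero, is
  differentiable everywhere: it follows the product rule on \<Omega> and vanishes on the open
  complement of \<open>K\<close>. Its directional derivative has integral 0.\<close>

lemma integration_by_parts_compact_support:
  fixes f :: "'a::euclidean_space \<Rightarrow> 'b::{banach,second_countable_topology}" and \<Phi> :: "'a \<Rightarrow> real"
  assumes \<Omega>: "open \<Omega>" and K: "compact K" "K \<subseteq> \<Omega>"
    and d\<Phi>: "\<And>x. (\<Phi> has_derivative \<Phi>' x) (at x)" "continuous_on \<Omega> (\<lambda>x. \<Phi>' x b)"
    and supp: "\<And>x. x \<notin> K \<Longrightarrow> \<Phi> x = 0"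
    and df: "\<And>x. x \<in> \<Omega> \<Longrightarrow> (f has_derivative f' x) (at x)" "continuous_on \<Omega> (\<lambda>x. f' x b)"
  shows "(LINT x|lebesgue_on \<Omega>. \<Phi>' x b *\<^sub>R f x) = - (LINT x|lebesgue_on \<Omega>. \<Phi> x *\<^sub>R f' x b)"
proof -
  have supp': "\<Phi>' x = (\<lambda>h. 0)" if "x \<notin> K" for x
  proof -
    have "(\<Phi> has_derivative (\<lambda>h. 0)) (at x)"
      by (rule has_derivative_transform_within_open[of "\<lambda>_. 0" _ _ _ "- K"])
        (use that supp K in \<open>auto intro: compact_imp_closed\<close>)
    then show ?thesis by (rule has_derivative_unique[OF d\<Phi>(1)])
  qed
  have contf: "continuous_on \<Omega> f"
    by (rule has_derivative_continuous_on[OF has_derivative_at_withinI[OF df(1)]])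
  have cont\<Phi>: "continuous_on \<Omega> \<Phi>"
    by (rule has_derivative_continuous_on[OF has_derivative_at_withinI[OF d\<Phi>(1)]])
  define F where "F x = (if x \<in> \<Omega> then \<Phi> x *\<^sub>R f x else 0)" for x
  define F' where "F' x = (if x \<in> \<Omega> then (\<lambda>h. \<Phi> x *\<^sub>R f' x h + \<Phi>' x h *\<^sub>R f x) else (\<lambda>h. 0))" for x
  have dF: "(F has_derivative F' x) (at x)" for x
  proof (cases "x \<in> \<Omega>")
    case True
    have "((\<lambda>x. \<Phi> x *\<^sub>R f x) has_derivative F' x) (at x)"
      using has_derivative_scaleR[OF d\<Phi>(1) df(1)[OF True]] True by (simp add: F'_def)
    then show ?thesis
      by (rule has_derivative_transform_within_open[OF _ \<Omega> True]) (simp add: F_def)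
  next
    case False
    have "(F has_derivative (\<lambda>h. 0)) (at x)"
      by (rule has_derivative_transform_within_open[of "\<lambda>_. 0" _ _ _ "- K"])
        (use False supp K in \<open>auto intro: compact_imp_closed simp: F_def\<close>)
    then show ?thesis using False by (simp add: F'_def)
  qed
  have contD: "continuous_on \<Omega> (\<lambda>x. \<Phi> x *\<^sub>R f' x b + \<Phi>' x b *\<^sub>R f x)"
    by (intro continuous_intros cont\<Phi> contf df d\<Phi>)
  have "bounded ((\<lambda>x. \<Phi> x *\<^sub>R f' x b + \<Phi>' x b *\<^sub>R f x) ` K)"
    by (intro compact_imp_bounded compact_continuous_image continuous_on_subset[OF contD] K)
  then obtain M where M: "M > 0" "\<And>x. x \<in> K \<Longrightarrow> norm (\<Phi> x *\<^sub>R f' x b + \<Phi>' x b *\<^sub>R f x) \<le> M"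
    unfolding bounded_pos by auto
  obtain R where R: "\<And>x. x \<in> K \<Longrightarrow> norm x \<le> R"
    using compact_imp_bounded[OF K(1)] unfolding bounded_iff by auto
  have "(LINT x|lborel. F' x b) = 0"
  proof (rule integral_directional_derivative_eq_0[OF dF, of _ M R])
    show "norm (F' x b) \<le> M" for x
      using M supp supp' K by (cases "x \<in> K") (auto simp: F'_def)
    show "F x = 0" if "R < norm x" for x
      using R supp that by (force simp: F_def)
  qed
  moreover have "(LINT x|lborel. F' x b) = (LINT x|lebesgue_on \<Omega>. \<Phi> x *\<^sub>R f' x b + \<Phi>' x b *\<^sub>R f x)"
  proof (subst lebesgue_on_integral_compact_support(3)[OF \<Omega> K contD])
    show "\<Phi> x *\<^sub>R f' x b + \<Phi>' x b *\<^sub>R f x = 0" if "x \<in> \<Omega> - K" for x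
      using supp[of x] supp'[of x] that by simp
  qed (rule Bochner_Integration.integral_cong, simp_all add: F'_def)
  moreover have "\<dots> = (LINT x|lebesgue_on \<Omega>. \<Phi> x *\<^sub>R f' x b) + (LINT x|lebesgue_on \<Omega>. \<Phi>' x b *\<^sub>R f x)"
    by (intro Bochner_Integration.integral_add lebesgue_on_integral_compact_support(2)[OF \<Omega> K]
        continuous_intros cont\<Phi> contf df d\<Phi>) (auto simp: supp supp')
  ultimately show ?thesis
    by (simp add: eq_neg_iff_add_eq_0 add.commute)
qed

section \<open>Classical derivatives as weak derivatives\<close>

lemma iter_partial_append: "iter_partial (bs @ cs) f = iter_partial bs (iter_partial cs f)"
  by (induction bs) auto

lemma smooth_on_iter_partial:
  assumes "smooth_on \<Omega> f" "cs \<in> lists Basis"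
  shows "smooth_on \<Omega> (iter_partial cs f)"
  unfolding smooth_on_def iter_partial_append[symmetric]
  using assms(1)[unfolded smooth_on_def] assms(2) by (simp add: append_in_lists_conv)

lemma smooth_on_imp_continuous_on:
  assumes "smooth_on \<Omega> f"
  shows "continuous_on \<Omega> f"
  using assms[unfolded smooth_on_def, rule_format, of "[]"]
  by (auto intro!: continuous_at_imp_continuous_on differentiable_imp_continuous_within)

lemma iter_partial_eq_0:
  assumes "open U" "\<And>x. x \<in> U \<Longrightarrow> f x = 0" "x \<in> U"
  shows "iter_partial bs f x = 0"
  using assms(3)
proof (induction bs arbitrary: x)
  case (Cons b bs)
  have "(iter_partial bs f has_derivative (\<lambda>h. 0)) (at x)"
    by (rule has_derivative_transform_within_open[of "\<lambda>_. 0" _ _ _ U])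
      (use Cons assms(1) in auto)
  from frechet_derivative_at[OF this] show ?case
    by (metis iter_partial.simps(2))
qed (use assms in auto)

text \<open>Integration by parts moves the outermost derivative of the test function first, and it
  becomes the innermost one on \<open>f\<close>. Hence the list is reversed, and no exchange of
  mixed partial derivatives enters.\<close>

lemma weak_derivative_smooth:
  assumes \<Omega>: "open \<Omega>" and "smooth_on \<Omega> f" "bs \<in> lists Basis"
  shows "weak_derivative \<Omega> bs f (iter_partial (rev bs) f)"
  using assms(2,3)
proof (induction bs arbitrary: f)
  case Nil
  then show ?case by (simp add: weak_derivative_def)
next
  case (Cons b bs)
  define g where "g = iter_partial [b] f"
  have b: "b \<in> Basis" "bs \<in> lists Basis" using Cons.prems by auto
  have sg: "smooth_on \<Omega> g"
    unfolding g_def using b Cons.prems by (intro smooth_on_iter_partial) auto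
  have IH: "weak_derivative \<Omega> bs g (iter_partial (rev bs) g)"
    using Cons.IH[OF sg] b by simp
  have "(LINT x|lebesgue_on \<Omega>. iter_partial (b # bs) \<phi> x *\<^sub>R f x) =
      - (LINT x|lebesgue_on \<Omega>. iter_partial bs \<phi> x *\<^sub>R g x)"
    if \<phi>: "\<phi> \<in> test_functions \<Omega>" for \<phi>
  proof -
    define K where "K = closure {x. \<phi> x \<noteq> 0}"
    have K: "compact K" "K \<subseteq> \<Omega>" and s: "smooth_on UNIV \<phi>"
      using \<phi> by (auto simp: test_functions_def K_def)
    have z: "iter_partial bs \<phi> x = 0" if "x \<notin> K" for x
      by (rule iter_partial_eq_0[of "- K"])
        (use that closure_subset[of "{x. \<phi> x \<noteq> 0}"] in \<open>auto simp: K_def\<close>)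
    have "continuous_on UNIV (iter_partial (b # bs) \<phi>)"
      using b by (intro smooth_on_imp_continuous_on smooth_on_iter_partial[OF s]) auto
    moreover have "(iter_partial bs \<phi> has_derivative frechet_derivative (iter_partial bs \<phi>) (at x)) (at x)" for x
      using s b unfolding smooth_on_def by (simp add: frechet_derivative_works[symmetric])
    moreover have "(f has_derivative frechet_derivative f (at x)) (at x)" if "x \<in> \<Omega>" for x
      using Cons.prems(1)[unfolded smooth_on_def, rule_format, of "[]"] that
      by (simp add: frechet_derivative_works[symmetric])
    ultimately show ?thesis
      unfolding g_def iter_partial.simps
      using smooth_on_imp_continuous_on[OF sg]
      by (intro integration_by_parts_compact_support[OF \<Omega> K])
         (auto simp: z g_def intro: continuous_on_subset)
  qed
  then show ?case
    using IH by (simp add: weak_derivative_def iter_partial_append g_def)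
qed

section \<open>Square-integrable functions and the Sobolev inclusion\<close>

lemma bounded_continuous_L2:
  assumes "open \<Omega>" "bounded \<Omega>" "continuous_on \<Omega> f" "\<And>x. x \<in> \<Omega> \<Longrightarrow> cmod (f x) \<le> B"
  shows "f \<in> L2 \<Omega>"
proof -
  have m[measurable]: "f \<in> borel_measurable (lebesgue_on \<Omega>)"
    using assms by (intro continuous_imp_measurable_on_sets_lebesgue) auto
  have "\<Omega> \<in> lmeasurable"
    using assms by (simp add: lmeasurable_open)
  then interpret finite_measure "lebesgue_on \<Omega>"
    by (rule finite_measure_lebesgue_on)
  have "integrable (lebesgue_on \<Omega>) (\<lambda>x. (cmod (f x))\<^sup>2)"
    using assms(4) by (intro integrable_const_bound[of _ "B\<^sup>2"])
      (auto intro!: AE_I2 power_mono simp: abs_square_le_1)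
  then show ?thesis by (simp add: L2_def m)
qed

lemma sobolev_antimono: "k \<le> l \<Longrightarrow> sobolev l \<Omega> \<subseteq> sobolev k \<Omega>"
  unfolding sobolev_def using le_trans by blast

lemma L2_mult_integrable:
  assumes "f \<in> L2 \<Omega>" "g \<in> L2 \<Omega>"
  shows "integrable (lebesgue_on \<Omega>) (\<lambda>x. f x * g x)"
proof (rule Bochner_Integration.integrable_bound)
  show "integrable (lebesgue_on \<Omega>) (\<lambda>x. (cmod (f x))\<^sup>2 + (cmod (g x))\<^sup>2)"
    using assms by (auto simp: L2_def)
  show "(\<lambda>x. f x * g x) \<in> borel_measurable (lebesgue_on \<Omega>)"
    using assms by (auto simp: L2_def)
  have "cmod (f x * g x) \<le> (cmod (f x))\<^sup>2 + (cmod (g x))\<^sup>2" for x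
  proof -
    have "0 \<le> cmod (f x) * cmod (g x)" by simp
    then show ?thesis
      using sum_squares_bound[of "cmod (f x)" "cmod (g x)"] unfolding norm_mult by linarith
  qed
  then show "AE x in lebesgue_on \<Omega>. norm (f x * g x) \<le> norm ((cmod (f x))\<^sup>2 + (cmod (g x))\<^sup>2)"
    by (auto intro!: AE_I2 order_trans[OF _ abs_ge_self])
qed

lemma L2_cnj: "f \<in> L2 \<Omega> \<Longrightarrow> (\<lambda>x. cnj (f x)) \<in> L2 \<Omega>"
  using measurable_compose[OF _ borel_measurable_continuous_onI[OF continuous_on_cnj[OF continuous_on_id]]]
  by (auto simp: L2_def)

lemma L2_diff:
  assumes "f \<in> L2 \<Omega>" "g \<in> L2 \<Omega>"
  shows "(\<lambda>x. f x - g x) \<in> L2 \<Omega>"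
proof -
  have "integrable (lebesgue_on \<Omega>) (\<lambda>x. (cmod (f x - g x))\<^sup>2)"
  proof (rule Bochner_Integration.integrable_bound)
    show "integrable (lebesgue_on \<Omega>) (\<lambda>x. 2 * (cmod (f x))\<^sup>2 + 2 * (cmod (g x))\<^sup>2)"
      using assms by (auto simp: L2_def)
    show "(\<lambda>x. (cmod (f x - g x))\<^sup>2) \<in> borel_measurable (lebesgue_on \<Omega>)"
      using assms by (auto simp: L2_def)
    have "(cmod (u - v))\<^sup>2 \<le> 2 * (cmod u)\<^sup>2 + 2 * (cmod v)\<^sup>2" for u v
    proof -
      have "(cmod (u - v))\<^sup>2 \<le> (cmod u + cmod v)\<^sup>2"
        by (intro power_mono norm_triangle_ineq4) auto
      also have "\<dots> \<le> 2 * (cmod u)\<^sup>2 + 2 * (cmod v)\<^sup>2"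
        using sum_squares_bound[of "cmod u" "cmod v"] by (simp add: power2_sum)
      finally show ?thesis .
    qed
    then show "AE x in lebesgue_on \<Omega>. norm ((cmod (f x - g x))\<^sup>2) \<le>
        norm (2 * (cmod (f x))\<^sup>2 + 2 * (cmod (g x))\<^sup>2)"
      by (auto intro!: AE_I2)
  qed
  then show ?thesis using assms by (auto simp: L2_def)
qed

text \<open>Each derivative extends continuously to a compact closure, hence is bounded and square
  integrable on the bounded set \<Omega>. Through this inclusion, leaving one Sobolev space already
  means leaving the class of functions smooth up to the closure.\<close>

lemma smooth_upto_closure_subset_sobolev:
  assumes "open \<Omega>" "bounded \<Omega>"
  shows "smooth_upto_closure \<Omega> \<subseteq> sobolev k \<Omega>"
proof
  fix f assume "f \<in> smooth_upto_closure \<Omega>"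
  then have s: "smooth_on \<Omega> f"
    and ext: "\<And>bs. bs \<in> lists Basis \<Longrightarrow> \<exists>g. continuous_on (closure \<Omega>) g \<and> (\<forall>x \<in> \<Omega>. g x = iter_partial bs f x)"
    by (auto simp: smooth_upto_closure_def)
  have L: "iter_partial bs f \<in> L2 \<Omega>" if bs: "bs \<in> lists Basis" for bs
  proof -
    obtain g where g: "continuous_on (closure \<Omega>) g" "\<And>x. x \<in> \<Omega> \<Longrightarrow> g x = iter_partial bs f x"
      using ext[OF bs] by blast
    have "bounded (g ` closure \<Omega>)"
      using assms g by (intro compact_imp_bounded compact_continuous_image) auto
    then obtain B where "\<And>x. x \<in> closure \<Omega> \<Longrightarrow> cmod (g x) \<le> B"
      unfolding bounded_iff by auto
    then have "\<And>x. x \<in> \<Omega> \<Longrightarrow> cmod (iter_partial bs f x) \<le> B"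
      using g(2) closure_subset by (metis subsetD)
    then show ?thesis
      using smooth_on_imp_continuous_on[OF smooth_on_iter_partial[OF s bs]] assms
      by (intro bounded_continuous_L2) auto
  qed
  show "f \<in> sobolev k \<Omega>"
    unfolding sobolev_def
  proof (intro CollectI conjI ballI impI)
    show "f \<in> L2 \<Omega>" using L[of "[]"] by simp
    fix bs assume "bs \<in> lists (Basis :: 'a set)"
    then show "\<exists>g\<in>L2 \<Omega>. weak_derivative \<Omega> bs f g"
      using weak_derivative_smooth[OF assms(1) s] L[of "rev bs"] by (metis in_lists_conv_set set_rev)
  qed
qed

section \<open>The conformal map of the lens\<close>

definition lens :: "complex set" where
  "lens = ball 0 1 \<inter> ball 1 1"

definition closed_lens :: "complex set" where
  "closed_lens = cball 0 1 \<inter> cball 1 1"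

text \<open>The upper intersection point exp(i pi/3) of the two unit circles; the lower one is its
  conjugate.\<close>

definition corner :: complex where
  "corner = Complex (1/2) (sqrt 3 / 2)"

text \<open>In the lens, |Im z| < sqrt 3 / 2, so \<open>corner - z\<close> and
  \<open>z - cnj corner\<close> both lie in the upper half-plane. The principal root is holomorphic
  there, both roots lie in the first quadrant, and their cubes are the 3/2 powers.\<close>

definition lens_p :: "complex \<Rightarrow> complex" where
  "lens_p z = csqrt (corner - z)"

definition lens_q :: "complex \<Rightarrow> complex" where
  "lens_q z = csqrt (z - cnj corner)"

text \<open>
  This is \<open>(F - 1) / (F + 1)\<close> for \<open>F\<close> the power \<open>3/2\<close> of the Moebius map \<open>(a - z) / (z - cnj a)\<close>, which
  sends the corners \<open>a\<close>, \<open>cnj a\<close> to \<open>0\<close>, \<open>\<infinity>\<close> and the lens to the sector \<open>\<bar>arg\<bar> < \<pi>/3\<close>; in this form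
  it is continuous at both corners.
\<close>

definition lens_map :: "complex \<Rightarrow> complex" where
  "lens_map z = (lens_p z ^ 3 - lens_q z ^ 3) / (lens_p z ^ 3 + lens_q z ^ 3)"

definition lens_map' :: "complex \<Rightarrow> complex" where
  "lens_map' z = - 3 * (corner - cnj corner) * lens_p z * lens_q z / (lens_p z ^ 3 + lens_q z ^ 3)\<^sup>2"

lemma lens_open: "open lens" and lens_bounded: "bounded lens"
  and closed_lens_compact: "compact closed_lens"
  and lens_subset_closed_lens: "lens \<subseteq> closed_lens"
  by (auto simp: lens_def closed_lens_def)

lemma mem_lens_iff:
  "z \<in> lens \<longleftrightarrow> (Re z)\<^sup>2 + (Im z)\<^sup>2 < 1 \<and> (Re z - 1)\<^sup>2 + (Im z)\<^sup>2 < 1"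
  by (simp add: lens_def dist_complex_def cmod_def power2_commute)

lemma mem_closed_lens_iff:
  "z \<in> closed_lens \<longleftrightarrow> (Re z)\<^sup>2 + (Im z)\<^sup>2 \<le> 1 \<and> (Re z - 1)\<^sup>2 + (Im z)\<^sup>2 \<le> 1"
  by (simp add: closed_lens_def dist_complex_def cmod_def power2_commute)

text \<open>The first bound is the average of the two disc inequalities. Its term in
  \<open>Re z\<close> shows that |Im z| = sqrt 3 / 2 is attained only at the two corners.\<close>

lemma closed_lens_Im:
  assumes "z \<in> closed_lens"
  shows "(Im z)\<^sup>2 \<le> (sqrt 3 / 2)\<^sup>2 - (Re z - 1/2)\<^sup>2" "\<bar>Im z\<bar> \<le> sqrt 3 / 2"
proof -
  show *: "(Im z)\<^sup>2 \<le> (sqrt 3 / 2)\<^sup>2 - (Re z - 1/2)\<^sup>2"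
    using assms unfolding mem_closed_lens_iff by (simp add: power2_eq_square algebra_simps)
  have "(Im z)\<^sup>2 \<le> (sqrt 3 / 2)\<^sup>2"
    using * zero_le_power2[of "Re z - 1/2"] by linarith
  then show "\<bar>Im z\<bar> \<le> sqrt 3 / 2"
    by (rule power2_le_imp_le[of "\<bar>Im z\<bar>", unfolded power2_abs]) simp
qed

lemma lens_Im: "z \<in> lens \<Longrightarrow> \<bar>Im z\<bar> < sqrt 3 / 2"
proof -
  assume "z \<in> lens"
  then have "(Im z)\<^sup>2 < (sqrt 3 / 2)\<^sup>2 - (Re z - 1/2)\<^sup>2"
    unfolding mem_lens_iff by (simp add: power2_eq_square algebra_simps)
  then have "(Im z)\<^sup>2 < (sqrt 3 / 2)\<^sup>2"
    using zero_le_power2[of "Re z - 1/2"] by linarith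
  then show "\<bar>Im z\<bar> < sqrt 3 / 2"
    by (rule power2_less_imp_less[of "\<bar>Im z\<bar>", unfolded power2_abs]) simp
qed

lemma Im_csqrt_nonneg: "0 \<le> Im z \<Longrightarrow> 0 \<le> Im (csqrt z)"
  using abs_Re_le_cmod[of z] by (auto simp: sgn_if)

text \<open>
  With \<open>p\<^sup>2 = a - z\<close> and \<open>q\<^sup>2 = z - cnj a\<close> for the corner \<open>a\<close>, the square of \<open>p * cnj q\<close> lies in
  the sector \<open>\<bar>arg\<bar> < \<pi>/3\<close> exactly when \<open>z\<close> is in the lens; the cube of \<open>p * cnj q\<close> then lies in
  the right half-plane.
\<close>

lemma lens_cube:
  defines "D \<equiv> \<lambda>z. Re (lens_p z ^ 3 * cnj (lens_q z ^ 3))"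
  shows "z \<in> lens \<Longrightarrow> 0 < D z"
    and "z \<in> closed_lens \<Longrightarrow> 0 \<le> D z"
    and "z \<in> closed_lens \<Longrightarrow> z \<notin> lens \<Longrightarrow> D z = 0"
proof -
  define s where "s = sqrt (3::real)"
  have s: "s * s = 3" "s > 0" by (auto simp: s_def)
  define \<alpha> \<beta> where "\<alpha> = Re (lens_p z * cnj (lens_q z))" and "\<beta> = Im (lens_p z * cnj (lens_q z))"
  have ab: "lens_p z * cnj (lens_q z) = Complex \<alpha> \<beta>"
    by (simp add: \<alpha>_def \<beta>_def complex_eq_iff)
  have sq: "(Complex \<alpha> \<beta>)\<^sup>2 = (corner - z) * cnj (z - cnj corner)"
    unfolding ab[symmetric] power_mult_distrib
    by (simp add: lens_p_def lens_q_def flip: complex_cnj_power)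
  have re: "\<alpha>\<^sup>2 - \<beta>\<^sup>2 = 1/2 + Re z - ((Re z)\<^sup>2 + (Im z)\<^sup>2)"
    using arg_cong[OF sq, of Re] s
    by (simp add: corner_def power2_eq_square algebra_simps s_def[symmetric])
  have im: "2 * (\<alpha> * \<beta>) = s * (Re z - 1/2)"
    using arg_cong[OF sq, of Im] by (simp add: corner_def power2_eq_square algebra_simps s_def)
  \<comment> \<open>The two circles bounding the lens correspond to the two rays bounding the
    sector: \<open>e1\<close> and \<open>e2\<close> match their defining functions up to the factor
    \<open>s\<close>.\<close>
  have e1: "s * (\<alpha>\<^sup>2 - \<beta>\<^sup>2) - 2 * (\<alpha> * \<beta>) = s * (1 - ((Re z)\<^sup>2 + (Im z)\<^sup>2))"
    unfolding re im by (simp add: algebra_simps)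
  have e2: "s * (\<alpha>\<^sup>2 - \<beta>\<^sup>2) + 2 * (\<alpha> * \<beta>) = s * (1 - ((Re z - 1)\<^sup>2 + (Im z)\<^sup>2))"
    unfolding re im by (simp add: algebra_simps power2_eq_square)
  have D: "D z = \<alpha> * (\<alpha>\<^sup>2 - 3 * \<beta>\<^sup>2)"
  proof -
    have "lens_p z ^ 3 * cnj (lens_q z ^ 3) = Complex \<alpha> \<beta> ^ 3"
      unfolding ab[symmetric] by (simp add: power_mult_distrib)
    then have "D z = Re (Complex \<alpha> \<beta> ^ 3)"
      unfolding D_def by (rule arg_cong)
    then show ?thesis
      by (simp add: power2_eq_square power3_eq_cube algebra_simps)
  qed
  \<comment> \<open>The product of the roots has half the argument of its square, so its sector is
    |arg| < pi/6, that is \<alpha> > sqrt 3 |\<beta>|. This factor occurs both in the circle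
    functions of \<open>e1\<close> and \<open>e2\<close> and in the real part of the cube, so its
    sign transfers from one to the other.\<close>
  have fac: "(\<alpha> - s * \<bar>\<beta>\<bar>) * (s * \<alpha> + \<bar>\<beta>\<bar>) = s * (\<alpha>\<^sup>2 - \<beta>\<^sup>2) - 2 * (\<alpha> * \<bar>\<beta>\<bar>)"
  proof -
    have "(\<alpha> - s * b) * (s * \<alpha> + b) = s * (\<alpha> * \<alpha>) + \<alpha> * b - (s * s) * (\<alpha> * b) - s * (b * b)" for b
      by (simp add: algebra_simps)
    from this[of "\<bar>\<beta>\<bar>"] show ?thesis
      unfolding s(1) abs_mult_self_eq by (simp add: power2_eq_square algebra_simps)
  qed
  have fac3: "\<alpha>\<^sup>2 - 3 * \<beta>\<^sup>2 = (\<alpha> - s * \<bar>\<beta>\<bar>) * (\<alpha> + s * \<bar>\<beta>\<bar>)"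
  proof -
    have "(\<alpha> - s * b) * (\<alpha> + s * b) = \<alpha> * \<alpha> - (s * s) * (b * b)" for b
      by (simp add: algebra_simps)
    from this[of "\<bar>\<beta>\<bar>"] show ?thesis
      unfolding s(1) abs_mult_self_eq by (simp add: power2_eq_square)
  qed
  \<comment> \<open>Squaring does not distinguish the sector from its negative; that both roots lie
    in the closed first quadrant selects the right one.\<close>
  have \<alpha>0: "0 \<le> \<alpha>" if "z \<in> closed_lens"
  proof -
    have "0 \<le> Im (corner - z)" "0 \<le> Im (z - cnj corner)"
      using closed_lens_Im(2)[OF that] by (auto simp: corner_def)
    then have "0 \<le> Im (lens_p z)" "0 \<le> Im (lens_q z)" "0 \<le> Re (lens_p z)" "0 \<le> Re (lens_q z)"
      unfolding lens_p_def lens_q_def using Im_csqrt_nonneg Re_csqrt by blast+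
    then show ?thesis by (simp add: \<alpha>_def)
  qed
  have pm: "\<alpha> * \<bar>\<beta>\<bar> = \<alpha> * \<beta> \<or> \<alpha> * \<bar>\<beta>\<bar> = - (\<alpha> * \<beta>)"
    by (auto simp: abs_if)
  {
    assume z: "z \<in> lens"
    then have a0: "0 \<le> \<alpha>" using \<alpha>0 lens_subset_closed_lens by blast
    have "0 < s * (1 - ((Re z)\<^sup>2 + (Im z)\<^sup>2))" "0 < s * (1 - ((Re z - 1)\<^sup>2 + (Im z)\<^sup>2))"
      using z s by (auto simp: mem_lens_iff)
    then have "0 < (\<alpha> - s * \<bar>\<beta>\<bar>) * (s * \<alpha> + \<bar>\<beta>\<bar>)"
      using pm e1 e2 unfolding fac by auto
    moreover have "0 \<le> s * \<alpha> + \<bar>\<beta>\<bar>" using a0 s by simp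
    ultimately have *: "0 < \<alpha> - s * \<bar>\<beta>\<bar>"
      by (metis leD mult_nonpos_nonneg not_le_imp_less)
    moreover have "0 \<le> s * \<bar>\<beta>\<bar>" using s by simp
    ultimately have "0 < \<alpha>" "0 < \<alpha> + s * \<bar>\<beta>\<bar>" by linarith+
    then show "0 < D z" unfolding D fac3 using * by simp
  }
  {
    assume z: "z \<in> closed_lens"
    note a0 = \<alpha>0[OF z]
    have "0 \<le> s * (1 - ((Re z)\<^sup>2 + (Im z)\<^sup>2))" "0 \<le> s * (1 - ((Re z - 1)\<^sup>2 + (Im z)\<^sup>2))"
      using z s by (auto simp: mem_closed_lens_iff)
    then have f: "0 \<le> (\<alpha> - s * \<bar>\<beta>\<bar>) * (s * \<alpha> + \<bar>\<beta>\<bar>)"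
      using pm e1 e2 unfolding fac by auto
    have "0 \<le> \<alpha> - s * \<bar>\<beta>\<bar>"
    proof (cases "\<alpha> = 0 \<and> \<beta> = 0")
      case False
      then have "0 < s * \<alpha> + \<bar>\<beta>\<bar>" using a0 s
        by (metis abs_ge_zero add_nonneg_eq_0_iff abs_eq_0 less_eq_real_def mult_eq_0_iff mult_nonneg_nonneg add_nonneg_nonneg order_less_irrefl)
      then show ?thesis using f by (simp add: zero_le_mult_iff)
    qed auto
    then show "0 \<le> D z" unfolding D fac3 using a0 s by simp
    assume "z \<notin> lens"
    then have "(Re z)\<^sup>2 + (Im z)\<^sup>2 = 1 \<or> (Re z - 1)\<^sup>2 + (Im z)\<^sup>2 = 1"
      using z by (auto simp: mem_lens_iff mem_closed_lens_iff)
    then have eq: "s * (\<alpha>\<^sup>2 - \<beta>\<^sup>2) = 2 * (\<alpha> * \<beta>) \<or> s * (\<alpha>\<^sup>2 - \<beta>\<^sup>2) = - (2 * (\<alpha> * \<beta>))"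
      using e1 e2 by auto
    have nn: "0 \<le> \<alpha> * \<bar>\<beta>\<bar>" using a0 by simp
    have ge: "2 * (\<alpha> * \<bar>\<beta>\<bar>) \<le> s * (\<alpha>\<^sup>2 - \<beta>\<^sup>2)" using f unfolding fac by simp
    then have "s * (\<alpha>\<^sup>2 - \<beta>\<^sup>2) = 2 * (\<alpha> * \<bar>\<beta>\<bar>)"
      using pm eq nn by auto
    then have "(\<alpha> - s * \<bar>\<beta>\<bar>) * (s * \<alpha> + \<bar>\<beta>\<bar>) = 0" unfolding fac by simp
    then consider "\<alpha> = s * \<bar>\<beta>\<bar>" | "s * \<alpha> + \<bar>\<beta>\<bar> = 0" by auto
    then show "D z = 0"
    proof cases
      case 1
      then show ?thesis unfolding D fac3 by simp
    next
      case 2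
      then have "\<alpha> = 0" using a0 s by (metis abs_ge_zero add_nonneg_eq_0_iff mult_eq_0_iff mult_nonneg_nonneg order_less_imp_le order_less_irrefl)
      then show ?thesis unfolding D by simp
    qed
  }
qed

text \<open>Turns the sign of Re (x cnj y) into a comparison of |x - y| with |x + y|; with cubes of
  the roots for x and y this is the comparison of |\<open>lens_map\<close>| with 1.\<close>

lemma cmod_diff_sum: "(cmod (x - y))\<^sup>2 = (cmod (x + y))\<^sup>2 - 4 * Re (x * cnj y)"
  unfolding cmod_power2 by (simp add: power2_eq_square algebra_simps)

text \<open>If the sum of the cubes vanished, the nonnegativity in \<open>lens_cube\<close> would
  force their difference to vanish as well. Both roots would then be 0 and z would be both corners
  at once.\<close>

lemma lens_p_q_sum_nonzero:
  assumes "z \<in> closed_lens"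
  shows "lens_p z ^ 3 + lens_q z ^ 3 \<noteq> 0"
proof
  assume eq: "lens_p z ^ 3 + lens_q z ^ 3 = 0"
  have "(cmod (lens_p z ^ 3 - lens_q z ^ 3))\<^sup>2 \<le> 0"
    using lens_cube(2)[OF assms] unfolding cmod_diff_sum eq by simp
  then have "lens_p z ^ 3 = lens_q z ^ 3" by simp
  then have "lens_p z = 0 \<and> lens_q z = 0" using eq by simp
  then have "corner = z" "z = cnj corner" unfolding lens_p_def lens_q_def csqrt_eq_0 by auto
  then show False by (auto simp: corner_def complex_eq_iff)
qed

lemma isCont_csqrt_0: "isCont csqrt 0"
proof -
  have "((\<lambda>z. sqrt (cmod z)) \<longlongrightarrow> sqrt (cmod 0)) (at (0::complex))"
    by (intro tendsto_intros)
  then have "(csqrt \<longlongrightarrow> 0) (at 0)"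
    by (intro tendsto_norm_zero_cancel[of csqrt]) simp
  then show ?thesis
    by (simp add: isCont_def)
qed

text \<open>The principal root is continuous off the nonpositive reals and also at 0. On the closed
  lens the radicand has positive imaginary part except at one corner, where it is 0.\<close>

lemma continuous_on_lens_p_q: "continuous_on closed_lens lens_p" "continuous_on closed_lens lens_q"
proof -
  have cont: "isCont csqrt w" if "0 < Im w \<or> w = 0" for w
    using that isCont_csqrt_0 continuous_at_csqrt[of w] by (auto simp: complex_nonpos_Reals_iff)
  have top: "Re z = 1/2" if "z \<in> closed_lens" "\<bar>Im z\<bar> = sqrt 3 / 2" for z
  proof -
    have "(Im z)\<^sup>2 = (sqrt 3 / 2)\<^sup>2" using that(2) by (metis power2_abs)
    then have "(Re z - 1/2)\<^sup>2 \<le> 0" using closed_lens_Im(1)[OF that(1)] by simp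
    then show ?thesis by simp
  qed
  have 1: "isCont csqrt (corner - z)" if z: "z \<in> closed_lens" for z
  proof (rule cont)
    show "0 < Im (corner - z) \<or> corner - z = 0"
      using closed_lens_Im(2)[OF z] top[OF z] by (auto simp: corner_def complex_eq_iff)
  qed
  have 2: "isCont csqrt (z - cnj corner)" if z: "z \<in> closed_lens" for z
  proof (rule cont)
    show "0 < Im (z - cnj corner) \<or> z - cnj corner = 0"
      using closed_lens_Im(2)[OF z] top[OF z] by (auto simp: corner_def complex_eq_iff)
  qed
  have "isCont lens_p z" if z: "z \<in> closed_lens" for z
    unfolding lens_p_def[abs_def]
    by (rule isCont_o2[where g = csqrt and f = "\<lambda>z. corner - z"]) (auto intro: 1[OF z])
  then show "continuous_on closed_lens lens_p" by (simp add: continuous_at_imp_continuous_on)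
  have "isCont lens_q z" if z: "z \<in> closed_lens" for z
    unfolding lens_q_def[abs_def]
    by (rule isCont_o2[where g = csqrt and f = "\<lambda>z. z - cnj corner"]) (auto intro: 2[OF z])
  then show "continuous_on closed_lens lens_q" by (simp add: continuous_at_imp_continuous_on)
qed

lemma lens_map_bound: "z \<in> lens \<Longrightarrow> cmod (lens_map z) < 1"
proof -
  assume z: "z \<in> lens"
  have n: "lens_p z ^ 3 + lens_q z ^ 3 \<noteq> 0"
    using z lens_subset_closed_lens lens_p_q_sum_nonzero by blast
  have "(cmod (lens_p z ^ 3 - lens_q z ^ 3))\<^sup>2 < (cmod (lens_p z ^ 3 + lens_q z ^ 3))\<^sup>2"
    using lens_cube(1)[OF z] unfolding cmod_diff_sum by simp
  then have "cmod (lens_p z ^ 3 - lens_q z ^ 3) < cmod (lens_p z ^ 3 + lens_q z ^ 3)"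
    by (rule power2_less_imp_less) simp
  then show ?thesis using n by (simp add: lens_map_def norm_divide)
qed

text \<open>With the denominator cleared, the sublevel condition is closed on the compact closed
  lens. It excludes boundary points, since there numerator and denominator have equal nonzero
  modulus while c < 1. Properness is the form in which the boundary behaviour of the conformal map
  enters the orthogonality argument.\<close>

lemma lens_map_proper:
  assumes "c < 1"
  shows "compact {z \<in> lens. (cmod (lens_map z))\<^sup>2 \<le> c}"
proof -
  let ?d = "\<lambda>z. (cmod (lens_p z ^ 3 - lens_q z ^ 3))\<^sup>2 - c * (cmod (lens_p z ^ 3 + lens_q z ^ 3))\<^sup>2"
  have "{z \<in> lens. (cmod (lens_map z))\<^sup>2 \<le> c} = {z \<in> closed_lens. ?d z \<in> {..0}}"
  proof (intro Collect_cong)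
    fix z
    have sub: "z \<in> lens" if z: "z \<in> closed_lens" "?d z \<le> 0"
    proof (rule ccontr)
      assume "z \<notin> lens"
      then have "Re (lens_p z ^ 3 * cnj (lens_q z ^ 3)) = 0"
        using lens_cube(3) z by simp
      then have "(1 - c) * (cmod (lens_p z ^ 3 + lens_q z ^ 3))\<^sup>2 \<le> 0"
        using z(2) unfolding cmod_diff_sum by (simp add: algebra_simps)
      then show False
        using assms lens_p_q_sum_nonzero[OF z(1)] by (simp add: mult_le_0_iff)
    qed
    have "(cmod (lens_map z))\<^sup>2 \<le> c \<longleftrightarrow> ?d z \<le> 0" if "z \<in> closed_lens"
      using lens_p_q_sum_nonzero[OF that]
      by (simp add: lens_map_def norm_divide power_divide divide_le_eq)
    then show "z \<in> lens \<and> (cmod (lens_map z))\<^sup>2 \<le> c \<longleftrightarrow> z \<in> closed_lens \<and> ?d z \<in> {..0}"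
      using sub lens_subset_closed_lens by auto
  qed
  moreover have "closed {z \<in> closed_lens. ?d z \<in> {..0}}"
    by (intro continuous_closed_preimage[unfolded vimage_def Int_def, simplified]
        continuous_intros continuous_on_lens_p_q compact_imp_closed[OF closed_lens_compact])
  ultimately show ?thesis
    using closed_lens_compact by (metis (no_types, lifting) bounded_subset compact_eq_bounded_closed mem_Collect_eq subsetI)
qed

section \<open>The derivative of the conformal map\<close>

lemma lens_csqrt_branch:
  assumes "z \<in> lens"
  shows "corner - z \<notin> \<real>\<^sub>\<le>\<^sub>0" "z - cnj corner \<notin> \<real>\<^sub>\<le>\<^sub>0"
  using lens_Im[OF assms] by (auto simp: complex_nonpos_Reals_iff corner_def)

lemma lens_p_has_derivative:
  "z \<in> lens \<Longrightarrow> (lens_p has_field_derivative - 1 / (2 * lens_p z)) (at z)"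
  unfolding lens_p_def[abs_def]
  by (auto intro!: derivative_eq_intros lens_csqrt_branch)

lemma lens_q_has_derivative:
  "z \<in> lens \<Longrightarrow> (lens_q has_field_derivative 1 / (2 * lens_q z)) (at z)"
  unfolding lens_q_def[abs_def]
  by (auto intro!: derivative_eq_intros lens_csqrt_branch)

lemma lens_p_q_nonzero:
  assumes "z \<in> lens"
  shows "lens_p z \<noteq> 0" "lens_q z \<noteq> 0"
  using lens_csqrt_branch[OF assms] unfolding lens_p_def lens_q_def csqrt_eq_0 by auto

text \<open>The cubes have derivatives -(3/2) p and (3/2) q without denominators, and the numerator
  of the quotient rule collapses to -3 (p^2 + q^2) p q. Here p^2 + q^2 is the constant
  \<open>corner - cnj corner\<close>, so the result stays continuous at the corners.\<close>

lemma lens_map_has_derivative: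
  assumes "z \<in> lens"
  shows "(lens_map has_field_derivative lens_map' z) (at z)"
proof -
  define P Q where "P = lens_p z" and "Q = lens_q z"
  note pq = lens_p_q_nonzero[OF assms, folded P_def Q_def]
  have n: "P ^ 3 + Q ^ 3 \<noteq> 0"
    using assms lens_subset_closed_lens lens_p_q_sum_nonzero unfolding P_def Q_def by blast
  have sq: "corner - cnj corner = P\<^sup>2 + Q\<^sup>2"
    by (simp add: P_def Q_def lens_p_def lens_q_def)
  have p3: "((\<lambda>z. lens_p z ^ 3) has_field_derivative - (3/2) * P) (at z)"
    using lens_p_has_derivative[OF assms] pq
    by (auto intro!: derivative_eq_intros simp: P_def[symmetric] field_simps power2_eq_square)
  have q3: "((\<lambda>z. lens_q z ^ 3) has_field_derivative (3/2) * Q) (at z)"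
    using lens_q_has_derivative[OF assms] pq
    by (auto intro!: derivative_eq_intros simp: Q_def[symmetric] field_simps power2_eq_square)
  have "(lens_map has_field_derivative
      ((- (3/2) * P - (3/2) * Q) * (P ^ 3 + Q ^ 3) - (P ^ 3 - Q ^ 3) * (- (3/2) * P + (3/2) * Q)) /
        ((P ^ 3 + Q ^ 3) * (P ^ 3 + Q ^ 3))) (at z)"
    unfolding lens_map_def[abs_def] P_def Q_def
    by (intro DERIV_divide DERIV_diff DERIV_add p3[unfolded P_def] q3[unfolded Q_def]
        n[unfolded P_def Q_def])
  moreover have "(- (3/2) * P - (3/2) * Q) * (P ^ 3 + Q ^ 3) - (P ^ 3 - Q ^ 3) * (- (3/2) * P + (3/2) * Q)
      = - 3 * (P\<^sup>2 + Q\<^sup>2) * P * Q"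
    by (simp add: algebra_simps power2_eq_square power3_eq_cube)
  ultimately show ?thesis
    by (simp only: lens_map'_def sq P_def[symmetric] Q_def[symmetric] power2_eq_square[of "P ^ 3 + Q ^ 3"])
qed

lemma lens_map_holomorphic: "lens_map holomorphic_on lens"
  using lens_map_has_derivative lens_open by (auto simp: holomorphic_on_open)

lemma deriv_lens_map: "z \<in> lens \<Longrightarrow> deriv lens_map z = lens_map' z"
  by (rule DERIV_imp_deriv) (rule lens_map_has_derivative)

lemma lens_map'_bounded: obtains B where "\<And>z. z \<in> lens \<Longrightarrow> cmod (lens_map' z) \<le> B"
proof -
  have "continuous_on closed_lens lens_map'"
    unfolding lens_map'_def[abs_def]
    by (intro continuous_intros continuous_on_lens_p_q) (auto simp: lens_p_q_sum_nonzero)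
  then have "bounded (lens_map' ` closed_lens)"
    using closed_lens_compact by (intro compact_imp_bounded compact_continuous_image)
  then show ?thesis
    using that lens_subset_closed_lens unfolding bounded_iff by blast
qed

section \<open>Orthogonality to holomorphic functions\<close>

lemma lebesgue_on_integral_borel:
  fixes G :: "'a::euclidean_space \<Rightarrow> 'b::{banach,second_countable_topology}"
  assumes "\<Omega> \<in> sets borel" "(\<lambda>x. if x \<in> \<Omega> then G x else 0) \<in> borel_measurable borel"
  shows "(LINT x|lebesgue_on \<Omega>. G x) = (LINT x|lborel. (if x \<in> \<Omega> then G x else 0))"
  using assms integral_completion[of "\<lambda>x. if x \<in> \<Omega> then G x else 0" lborel]
  by (subst integral_restrict_space) (simp_all add: indicator_scaleR_eq_if)

lemma holomorphic2_on_continuous_on: "holomorphic2_on g \<Omega> \<Longrightarrow> continuous_on \<Omega> g"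
  unfolding holomorphic2_on_def
  by (meson continuous_at_imp_continuous_on has_derivative_continuous)

text \<open>The coefficient \<open>a\<close> comes from pointwise differentiability, so its
  continuity is not at hand. Cauchy's inequality on discs of a fixed radius in the first variable
  bounds it by the supremum of the continuous function \<open>g\<close> on a compact
  neighbourhood.\<close>

lemma holomorphic2_partial_bounded:
  assumes L: "open L" "compact K" "K \<subseteq> L" and V: "compact K'" "K' \<subseteq> V"
    and d: "\<And>z. z \<in> L \<times> V \<Longrightarrow> (g has_derivative (\<lambda>h. a z * fst h + b z * snd h)) (at z)"
  obtains M where "\<And>z. z \<in> K \<times> K' \<Longrightarrow> cmod (a z) \<le> M"
proof -
  obtain e where e: "e > 0" "(\<Union>x\<in>K. cball x e) \<subseteq> L"
    using compact_subset_open_imp_cball_epsilon_subset[OF L(2,1,3)] by blast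
  \<comment> \<open>The closed e-neighbourhood of \<open>K\<close>, written as a sum of two compact
    sets so that its compactness is immediate.\<close>
  define K1 where "K1 = {x + y | x y. x \<in> K \<and> y \<in> cball 0 e}"
  have K1: "compact K1"
    unfolding K1_def by (rule compact_sums) (use L in auto)
  have cb: "cball x e \<subseteq> K1" if "x \<in> K" for x
  proof
    fix y assume "y \<in> cball x e"
    then have "y = x + (y - x)" "y - x \<in> cball 0 e" by (auto simp: dist_norm norm_minus_commute)
    then show "y \<in> K1" using that unfolding K1_def by blast
  qed
  have "K1 \<subseteq> L"
  proof
    fix w assume "w \<in> K1"
    then obtain x y where "w = x + y" "x \<in> K" "y \<in> cball 0 e" unfolding K1_def by auto
    then show "w \<in> L" using e(2) by (force simp: dist_norm)
  qed
  then have sub: "K1 \<times> K' \<subseteq> L \<times> V" using V by auto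
  have contg: "continuous_on (L \<times> V) g"
    by (rule has_derivative_continuous_on[OF has_derivative_at_withinI[OF d]])
  have "bounded (g ` (K1 \<times> K'))"
    by (intro compact_imp_bounded compact_continuous_image compact_Times K1 V continuous_on_subset[OF contg sub])
  then obtain M where M: "\<And>z. z \<in> K1 \<times> K' \<Longrightarrow> cmod (g z) \<le> M"
    unfolding bounded_iff by blast
  have "cmod (a z) \<le> M / e" if z: "z \<in> K \<times> K'" for z
  proof -
    obtain x y where xy: "z = (x, y)" "x \<in> K" "y \<in> K'" using z by auto
    have fd: "((\<lambda>x. g (x, y)) has_field_derivative a (w, y)) (at w)" if "w \<in> K1" for w
    proof -
      have "((\<lambda>x. (x, y)) has_derivative (\<lambda>h. (h, 0))) (at w)"
        by (intro has_derivative_Pair has_derivative_ident has_derivative_const)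
      from has_derivative_compose[OF this d[of "(w, y)"]] that sub xy(3)
      show ?thesis by (auto simp: has_field_derivative_def)
    qed
    have hol: "(\<lambda>x. g (x, y)) holomorphic_on cball x e"
      unfolding holomorphic_on_def field_differentiable_def
      by (intro ballI exI, rule has_field_derivative_at_within[OF fd]) (use cb[OF xy(2)] in blast)
    have "cmod ((deriv ^^ 1) (\<lambda>x. g (x, y)) x) \<le> fact 1 * M / e ^ 1"
    proof (rule Cauchy_inequality)
      show "(\<lambda>x. g (x, y)) holomorphic_on ball x e"
        using hol ball_subset_cball holomorphic_on_subset by blast
      show "continuous_on (cball x e) (\<lambda>x. g (x, y))"
        using hol by (rule holomorphic_on_imp_continuous_on)
      show "cmod (g (w, y)) \<le> M" if "cmod (x - w) = e" for w
      proof -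
        have "w \<in> cball x e" using that by (simp add: dist_norm)
        then show ?thesis using M[of "(w, y)"] cb[OF xy(2)] xy(3) by auto
      qed
    qed (use e in auto)
    moreover have "deriv (\<lambda>x. g (x, y)) x = a z"
      unfolding xy(1) by (rule DERIV_imp_deriv[OF fd]) (use cb[OF xy(2)] e in auto)
    ultimately show ?thesis by simp
  qed
  then show ?thesis by (rule that)
qed

text \<open>The product of \<open>u\<close>, \<open>\<kappa>\<close> and \<open>g\<close> has
  compact support, so its derivatives in the directions 1 and i of the first variable integrate to
  0. Their combination is twice the z1-bar-derivative: it annihilates the holomorphic
  \<open>g\<close>, does not touch \<open>\<kappa>\<close>, and turns \<open>u\<close> into
  \<open>B\<close>.\<close>

lemma dbar_integral_eq_0:
  fixes u :: "complex \<Rightarrow> complex" and \<kappa> :: "complex \<Rightarrow> real"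
  assumes L: "open L" "compact K" "K \<subseteq> L" and V: "open V" "compact K'" "K' \<subseteq> V"
    and g: "holomorphic2_on g (L \<times> V)"
    and du: "\<And>x. x \<in> L \<Longrightarrow> (u has_derivative (\<lambda>h. A x * h + B x * cnj h)) (at x)"
    and bd: "\<And>x. x \<in> K \<Longrightarrow> cmod (A x) \<le> M" "\<And>x. x \<in> K \<Longrightarrow> cmod (B x) \<le> M"
    and supp: "\<And>x. x \<in> L - K \<Longrightarrow> u x = 0 \<and> A x = 0 \<and> B x = 0"
    and d\<kappa>: "\<And>y. (\<kappa> has_derivative \<kappa>' y) (at y)" and supp\<kappa>: "\<And>y. y \<notin> K' \<Longrightarrow> \<kappa> y = 0"
  shows "(LINT z|lebesgue_on (L \<times> V). B (fst z) * of_real (\<kappa> (snd z)) * g z) = 0"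
proof -
  obtain a b where d: "\<And>z. z \<in> L \<times> V \<Longrightarrow> (g has_derivative (\<lambda>h. a z * fst h + b z * snd h)) (at z)"
    using g unfolding holomorphic2_on_def by metis
  have \<kappa>0: "\<kappa>' y 0 = 0" for y
    using d\<kappa> by (meson has_derivative_linear linear_0)
  define F where "F z = (if z \<in> L \<times> V then u (fst z) * of_real (\<kappa> (snd z)) * g z else 0)" for z
  define F' where "F' z h = (if z \<in> L \<times> V then
      (A (fst z) * fst h + B (fst z) * cnj (fst h)) * of_real (\<kappa> (snd z)) * g z +
      u (fst z) * of_real (\<kappa>' (snd z) (snd h)) * g z +
      u (fst z) * of_real (\<kappa> (snd z)) * (a z * fst h + b z * snd h) else 0)" for z h
  have op: "open (L \<times> V)" using L V by (simp add: open_Times)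
  have F0: "F z = 0" if "z \<notin> K \<times> K'" for z
    using that supp[of "fst z"] supp\<kappa>[of "snd z"] by (cases z) (auto simp: F_def)
  have dF: "(F has_derivative F' z) (at z)" for z
  proof (cases "z \<in> L \<times> V")
    case True
    have 1: "((\<lambda>z. u (fst z)) has_derivative (\<lambda>h. A (fst z) * fst h + B (fst z) * cnj (fst h))) (at z)"
      by (rule has_derivative_compose[OF has_derivative_fst[OF has_derivative_ident] du]) (use True in auto)
    have 2: "((\<lambda>z. complex_of_real (\<kappa> (snd z))) has_derivative (\<lambda>h. of_real (\<kappa>' (snd z) (snd h)))) (at z)"
      by (intro bounded_linear.has_derivative[OF bounded_linear_of_real]
        has_derivative_compose[OF has_derivative_snd[OF has_derivative_ident] d\<kappa>])
    have "((\<lambda>z. u (fst z) * of_real (\<kappa> (snd z)) * g z) has_derivative F' z) (at z)"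
      using has_derivative_mult[OF has_derivative_mult[OF 1 2] d[OF True]] True
      by (rule_tac has_derivative_eq_rhs) (auto simp: F'_def fun_eq_iff algebra_simps)
    then show ?thesis
      by (rule has_derivative_transform_within_open[OF _ op True]) (simp add: F_def)
  next
    case False
    have "open (- (K \<times> K'))" using L V by (intro open_Compl compact_imp_closed compact_Times)
    then have "(F has_derivative (\<lambda>h. 0)) (at z)"
      by (rule has_derivative_transform_within_open[OF has_derivative_const])
        (use False F0 L V in auto)
    moreover have "F' z = (\<lambda>h. 0)" using False by (auto simp: F'_def fun_eq_iff)
    ultimately show ?thesis by simp
  qed
  have contu: "continuous_on L u"
    by (rule has_derivative_continuous_on[OF has_derivative_at_withinI[OF du]])
  have cont\<kappa>: "continuous_on UNIV \<kappa>"
    by (rule has_derivative_continuous_on[OF has_derivative_at_withinI[OF d\<kappa>]])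
  obtain Mu where Mu: "\<And>x. x \<in> K \<Longrightarrow> cmod (u x) \<le> Mu" "0 \<le> Mu"
    using compact_imp_bounded[OF compact_continuous_image[OF continuous_on_subset[OF contu L(3)] L(2)]]
    unfolding bounded_pos by (auto intro: order_less_imp_le)
  obtain Mk where Mk: "\<And>y. y \<in> K' \<Longrightarrow> \<bar>\<kappa> y\<bar> \<le> Mk" "0 \<le> Mk"
    using compact_imp_bounded[OF compact_continuous_image[OF continuous_on_subset[OF cont\<kappa> subset_UNIV] V(2)]]
    unfolding bounded_pos by (auto intro: order_less_imp_le)
  obtain Mg where Mg: "\<And>z. z \<in> K \<times> K' \<Longrightarrow> cmod (g z) \<le> Mg" "0 \<le> Mg"
  proof -
    have "continuous_on (K \<times> K') g"
      using holomorphic2_on_continuous_on[OF g] L V by (blast intro: continuous_on_subset)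
    from compact_imp_bounded[OF compact_continuous_image[OF this compact_Times[OF L(2) V(2)]]]
    show ?thesis using that unfolding bounded_pos by (auto intro: order_less_imp_le)
  qed
  obtain Ma where Ma: "\<And>z. z \<in> K \<times> K' \<Longrightarrow> cmod (a z) \<le> Ma"
    by (rule holomorphic2_partial_bounded[OF L V(2,3) d]) (use that in blast)+
  define R where "R = \<bar>(M + M) * Mk * Mg + Mu * Mk * Ma\<bar>"
  have bound: "cmod (F' z (c, 0)) \<le> R" if c: "cmod c = 1" for z c
  proof (cases "z \<in> K \<times> K'")
    case True
    then have K: "fst z \<in> K" "snd z \<in> K'" "z \<in> L \<times> V" using L V by auto
    have M0: "0 \<le> M" "0 \<le> Ma"
      using order_trans[OF norm_ge_zero bd(1)[OF K(1)]] order_trans[OF norm_ge_zero Ma[OF True]] by auto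
    have "cmod (A (fst z) * c + B (fst z) * cnj c) \<le> M + M"
      by (rule order_trans[OF norm_triangle_ineq]) (use add_mono[OF bd[OF K(1)]] c in \<open>simp add: norm_mult\<close>)
    then have "cmod ((A (fst z) * c + B (fst z) * cnj c) * of_real (\<kappa> (snd z)) * g z) \<le> (M + M) * Mk * Mg"
      unfolding norm_mult norm_of_real using Mk Mg True K M0 by (intro mult_mono) auto
    moreover have "cmod (u (fst z) * of_real (\<kappa> (snd z)) * (a z * c)) \<le> Mu * Mk * Ma"
      unfolding norm_mult norm_of_real c mult_1_right using Mk Mu Ma[OF True] K M0 by (intro mult_mono) auto
    ultimately show ?thesis
      using K(3) \<kappa>0 unfolding F'_def R_def
      by (simp add: order_trans[OF norm_triangle_mono abs_ge_self])
  next
    case False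
    have "F' z (c, 0) = 0"
      using False supp[of "fst z"] supp\<kappa>[of "snd z"] \<kappa>0 by (cases z) (auto simp: F'_def)
    then show ?thesis
      by (simp add: R_def)
  qed
  obtain R' where R': "\<And>z. z \<in> K \<times> K' \<Longrightarrow> norm z \<le> R'"
    using compact_imp_bounded[OF compact_Times[OF L(2) V(2)]] unfolding bounded_iff by blast
  have out: "F z = 0" if "norm z > R'" for z
    using R'[of z] F0[of z] that by (cases "z \<in> K \<times> K'") auto
  note I = integral_directional_derivative_eq_0[OF dF bound out]
  \<comment> \<open>The contributions of \<open>A\<close> and \<open>a\<close>, being complex linear
    in the direction, cancel; the conjugate linear part \<open>B\<close> doubles.\<close>
  have eq: "F' z (1, 0) + \<i> * F' z (\<i>, 0) =
      2 * (if z \<in> L \<times> V then B (fst z) * of_real (\<kappa> (snd z)) * g z else 0)" for z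
    by (auto simp: F'_def \<kappa>0 algebra_simps)
  have i: "integrable lborel (\<lambda>z. F' z (1, 0))" "integrable lborel (\<lambda>z. \<i> * F' z (\<i>, 0))"
    by (auto intro!: I(1))
  have int: "integrable lborel (\<lambda>z. F' z (1, 0) + \<i> * F' z (\<i>, 0))"
    using i by (rule Bochner_Integration.integrable_add)
  have "(LINT z|lborel. F' z (1, 0) + \<i> * F' z (\<i>, 0)) = 0"
    using i I(2)[of 1] I(2)[of \<i>] by simp
  then have z: "(LINT z|lborel. (if z \<in> L \<times> V then B (fst z) * of_real (\<kappa> (snd z)) * g z else 0)) = 0"
    unfolding eq by simp
  \<comment> \<open>The hypotheses bound \<open>B\<close> but give no continuity, so measurability
    of the integrand is read off from the integrable left side of \<open>eq\<close>.\<close>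
  have "(\<lambda>z. 2 * (if z \<in> L \<times> V then B (fst z) * of_real (\<kappa> (snd z)) * g z else 0)) \<in> borel_measurable lborel"
    using borel_measurable_integrable[OF int] unfolding eq .
  then have "(\<lambda>z. (1/2) * (2 * (if z \<in> L \<times> V then B (fst z) * of_real (\<kappa> (snd z)) * g z else 0))) \<in> borel_measurable lborel"
    by (rule borel_measurable_times[OF borel_measurable_const])
  then have "(\<lambda>z. (if z \<in> L \<times> V then B (fst z) * of_real (\<kappa> (snd z)) * g z else 0)) \<in> borel_measurable borel"
    by simp
  then show ?thesis
    using op z by (subst lebesgue_on_integral_borel) auto
qed

text \<open>Since |\<phi>|^2 is \<phi> times its conjugate, the d-bar-derivative of T(|\<phi>|^2) is
  T' \<phi> cnj \<phi>'. Division by the holomorphic \<phi> leaves T' cnj \<phi>', the coefficient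
  of \<open>cnj h\<close>.\<close>

lemma has_derivative_radial_quotient:
  assumes d: "(\<phi> has_field_derivative \<phi>') (at x)" and n: "\<phi> x \<noteq> 0"
    and T: "(T has_real_derivative T') (at ((cmod (\<phi> x))\<^sup>2))"
  shows "((\<lambda>x. of_real (T ((cmod (\<phi> x))\<^sup>2)) / \<phi> x) has_derivative
    (\<lambda>h. (of_real T' * cnj (\<phi> x) * \<phi>' / \<phi> x - of_real (T ((cmod (\<phi> x))\<^sup>2)) * \<phi>' / (\<phi> x * \<phi> x)) * h +
         of_real T' * cnj \<phi>' * cnj h)) (at x)"
proof -
  have d': "(\<phi> has_derivative (\<lambda>h. \<phi>' * h)) (at x)"
    using d by (simp add: has_field_derivative_def)
  have "((\<lambda>x. \<phi> x \<bullet> \<phi> x) has_derivative (\<lambda>h. \<phi> x \<bullet> (\<phi>' * h) + (\<phi>' * h) \<bullet> \<phi> x)) (at x)"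
    by (rule has_derivative_inner[OF d' d'])
  then have "((\<lambda>x. (cmod (\<phi> x))\<^sup>2) has_derivative (\<lambda>h. 2 * (\<phi> x \<bullet> (\<phi>' * h)))) (at x)"
    by (simp add: power2_norm_eq_inner inner_commute)
  from has_derivative_compose[OF this T[unfolded has_field_derivative_def]]
  have 1: "((\<lambda>x. complex_of_real (T ((cmod (\<phi> x))\<^sup>2))) has_derivative
      (\<lambda>h. of_real (T' * (2 * (\<phi> x \<bullet> (\<phi>' * h)))))) (at x)"
    by (rule bounded_linear.has_derivative[OF bounded_linear_of_real])
  have re: "complex_of_real (2 * (v \<bullet> w)) = cnj v * w + v * cnj w" for v w
    by (simp add: complex_eq_iff inner_complex_def)
  show ?thesis
  proof (rule has_derivative_eq_rhs[OF has_derivative_divide'[OF 1 d' n]], rule ext)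
    fix h
    have "((of_real T' * (cnj (\<phi> x) * (\<phi>' * h) + \<phi> x * cnj (\<phi>' * h))) * \<phi> x -
        of_real (T ((cmod (\<phi> x))\<^sup>2)) * (\<phi>' * h)) / (\<phi> x * \<phi> x) =
      (of_real T' * cnj (\<phi> x) * \<phi>' / \<phi> x - of_real (T ((cmod (\<phi> x))\<^sup>2)) * \<phi>' / (\<phi> x * \<phi> x)) * h +
         of_real T' * cnj \<phi>' * cnj h"
      using n by (simp add: divide_simps) (simp add: algebra_simps)
    then show "(of_real (T' * (2 * (\<phi> x \<bullet> (\<phi>' * h)))) * \<phi> x -
        of_real (T ((cmod (\<phi> x))\<^sup>2)) * (\<phi>' * h)) / (\<phi> x * \<phi> x) =
      (of_real T' * cnj (\<phi> x) * \<phi>' / \<phi> x - of_real (T ((cmod (\<phi> x))\<^sup>2)) * \<phi>' / (\<phi> x * \<phi> x)) * h +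
         of_real T' * cnj \<phi>' * cnj h"
      unfolding of_real_mult[of T'] re .
  qed
qed

lemma bounded_on_unit_interval:
  fixes f :: "real \<Rightarrow> real"
  assumes "continuous_on UNIV f"
  obtains M where "0 \<le> M" "\<And>s. 0 \<le> s \<Longrightarrow> s \<le> 1 \<Longrightarrow> \<bar>f s\<bar> \<le> M"
proof -
  have "bounded (f ` {0..1})"
    by (intro compact_imp_bounded compact_continuous_image continuous_on_subset[OF assms]) auto
  then obtain M where "0 < M" "\<forall>x\<in>f ` {0..1}. norm x \<le> M"
    unfolding bounded_pos by blast
  then show ?thesis using that[of M] by auto
qed

lemma has_real_derivative_continuous_on:
  "(\<And>x. (f has_real_derivative f' x) (at x)) \<Longrightarrow> continuous_on UNIV f"
  by (meson DERIV_isCont continuous_at_imp_continuous_on)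

section \<open>The orthogonality relation for a proper holomorphic map to the disc\<close>

context
  fixes L :: "complex set" and \<phi> :: "complex \<Rightarrow> complex" and B :: real
    and N :: "complex \<Rightarrow> real" and \<Omega> :: "(complex \<times> complex) set"
  assumes L: "open L" "bounded L" and \<phi>: "\<phi> holomorphic_on L"
    and \<phi>1: "\<And>x. x \<in> L \<Longrightarrow> cmod (\<phi> x) < 1"
    and proper: "\<And>c. c < 1 \<Longrightarrow> compact {x \<in> L. (cmod (\<phi> x))\<^sup>2 \<le> c}"
    and B: "\<And>x. x \<in> L \<Longrightarrow> cmod (deriv \<phi> x) \<le> B"
  defines "N \<equiv> \<lambda>x. (cmod (\<phi> x))\<^sup>2" and "\<Omega> \<equiv> L \<times> ball 0 1"
begin

lemma N_bounds: "x \<in> L \<Longrightarrow> N x < 1" "0 \<le> N x"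
  using \<phi>1[of x] by (auto simp: N_def power_less_one_iff)

text \<open>The version with cutoffs: \<open>T\<close> vanishes for arguments beyond
  \<open>c\<close>, so by properness T(|\<phi>|^2) / \<phi> has compact support in \<open>L\<close>,
  and \<open>\<kappa>\<close> confines the second variable to a compact disc.\<close>

lemma radial_orthogonality_compact:
  fixes T T' :: "real \<Rightarrow> real"
  assumes T: "\<And>s. (T has_real_derivative T' s) (at s)" "continuous_on UNIV T'"
    and inner: "\<And>s. s \<le> 1/4 \<Longrightarrow> T s = 0" "\<And>s. s \<le> 1/4 \<Longrightarrow> T' s = 0"
    and outer: "\<And>s. s \<ge> c \<Longrightarrow> T s = 0" "\<And>s. s \<ge> c \<Longrightarrow> T' s = 0" and c: "c < 1"
    and \<kappa>: "\<And>s. (\<kappa> has_real_derivative \<kappa>' s) (at s)" "\<And>s. s \<ge> c \<Longrightarrow> \<kappa> s = 0"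
    and g: "holomorphic2_on g \<Omega>"
  shows "(LINT z|lebesgue_on \<Omega>. of_real (T' (N (fst z))) * cnj (deriv \<phi> (fst z)) *
      of_real (\<kappa> ((cmod (snd z))\<^sup>2)) * g z) = 0"
proof -
  define u where "u x = of_real (T (N x)) / \<phi> x" for x
  define A where "A x = of_real (T' (N x)) * cnj (\<phi> x) * deriv \<phi> x / \<phi> x -
      of_real (T (N x)) * deriv \<phi> x / (\<phi> x * \<phi> x)" for x
  define D where "D x = of_real (T' (N x)) * cnj (deriv \<phi> x)" for x
  define K where "K = {x \<in> L. N x \<le> c}"
  define K' where "K' = {y::complex. (cmod y)\<^sup>2 \<le> c}"
  have K: "compact K" "K \<subseteq> L" using proper[OF c] by (auto simp: K_def N_def)
  have K'b: "K' \<subseteq> ball 0 1"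
  proof
    fix y assume "y \<in> K'"
    then have "(cmod y)\<^sup>2 < 1\<^sup>2" using c by (simp add: K'_def)
    then show "y \<in> ball 0 1" by (metis dist_0_norm mem_ball power2_less_imp_less zero_le_one)
  qed
  have "closed K'"
    unfolding K'_def by (intro closed_Collect_le continuous_intros)
  then have K': "compact K'"
    using K'b by (meson bounded_ball bounded_subset compact_eq_bounded_closed)
  have d\<phi>: "(\<phi> has_field_derivative deriv \<phi> x) (at x)" if "x \<in> L" for x
    using that L(1) \<phi> by (auto intro: holomorphic_derivI)
  have contN: "continuous_on L N"
    unfolding N_def using \<phi> by (intro continuous_intros holomorphic_on_imp_continuous_on)
  have du: "(u has_derivative (\<lambda>h. A x * h + D x * cnj h)) (at x)" if x: "x \<in> L" for x
  \<comment> \<open>Here \<phi> may vanish, but \<open>T\<close> and \<open>T'\<close> are 0 near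
    the point; since 0 / 0 = 0, the formulas for \<open>u\<close>, \<open>A\<close> and
    \<open>D\<close> give 0 as well.\<close>
  proof (cases "N x < 1/4")
    case True
    have op: "open {x \<in> L. N x < 1/4}"
      using continuous_open_preimage[OF contN L(1), of "{..<1/4}"] by (simp add: vimage_def Int_def)
    have "(u has_derivative (\<lambda>h. 0)) (at x)"
      by (rule has_derivative_transform_within_open[OF has_derivative_const op])
        (use x True inner in \<open>auto simp: u_def\<close>)
    moreover have "A x = 0" "D x = 0" using True inner by (auto simp: A_def D_def)
    ultimately show ?thesis by simp
  next
    case False
    then have "\<phi> x \<noteq> 0" by (auto simp: N_def)
    from has_derivative_radial_quotient[OF d\<phi>[OF x] this T(1)]
    show ?thesis unfolding u_def[abs_def] A_def D_def N_def .
  qed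
  obtain M1 where M1: "0 \<le> M1" "\<And>s. 0 \<le> s \<Longrightarrow> s \<le> 1 \<Longrightarrow> \<bar>T s\<bar> \<le> M1"
    using bounded_on_unit_interval[OF has_real_derivative_continuous_on[OF T(1)]] by blast
  obtain M2 where M2: "0 \<le> M2" "\<And>s. 0 \<le> s \<Longrightarrow> s \<le> 1 \<Longrightarrow> \<bar>T' s\<bar> \<le> M2"
    using bounded_on_unit_interval[OF T(2)] by blast
  \<comment> \<open>The factor 4 bounds 1/|\<phi>|^2 where |\<phi>|^2 > 1/4, the only place where
    \<open>T\<close> can be nonzero.\<close>
  define M where "M = M2 * B + 4 * M1 * B"
  have bd: "cmod (A x) \<le> M" "cmod (D x) \<le> M" if xK: "x \<in> K" for x
  proof -
    have x: "x \<in> L" and N: "0 \<le> N x" "N x \<le> 1"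
      using xK K N_bounds[of x] by auto
    have B0: "0 \<le> B" using B[OF x] norm_ge_zero order_trans by blast
    have T2: "\<bar>T' (N x)\<bar> * cmod (deriv \<phi> x) \<le> M2 * B"
      using M2 N B[OF x] by (intro mult_mono) auto
    have r0: "0 \<le> 4 * M1 * B" using M1 B0 by simp
    show "cmod (D x) \<le> M"
      unfolding D_def M_def norm_mult norm_of_real complex_mod_cnj using T2 r0 by linarith
    show "cmod (A x) \<le> M"
    proof (cases "N x \<le> 1/4")
      case True
      then show ?thesis using M1 M2 B0 by (simp add: A_def inner M_def)
    next
      case False
      then have ph: "\<phi> x \<noteq> 0" and N4: "N x > 1/4" by (auto simp: N_def)
      have "cmod (of_real (T (N x)) * deriv \<phi> x / (\<phi> x * \<phi> x)) = \<bar>T (N x)\<bar> * cmod (deriv \<phi> x) / N x"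
        by (simp add: norm_mult norm_divide N_def power2_eq_square)
      also have "\<dots> \<le> (M1 * B) / (1/4)"
        using M1 N N4 B[OF x] B0 by (intro frac_le mult_mono) auto
      finally have 2: "cmod (of_real (T (N x)) * deriv \<phi> x / (\<phi> x * \<phi> x)) \<le> 4 * M1 * B" by simp
      have "cmod (of_real (T' (N x)) * cnj (\<phi> x) * deriv \<phi> x / \<phi> x) = \<bar>T' (N x)\<bar> * cmod (deriv \<phi> x)"
        using ph by (simp add: norm_mult norm_divide)
      then show ?thesis
        unfolding A_def M_def using 2 T2
        by (intro order_trans[OF norm_triangle_ineq4] add_mono) auto
    qed
  qed
  have supp: "u x = 0 \<and> A x = 0 \<and> D x = 0" if "x \<in> L - K" for x
    using that outer[of "N x"] by (auto simp: K_def u_def A_def D_def)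
  have d\<kappa>: "((\<lambda>y. \<kappa> ((cmod y)\<^sup>2)) has_derivative (\<lambda>h. \<kappa>' ((cmod y)\<^sup>2) * (2 * (y \<bullet> h)))) (at y)" for y :: complex
  proof -
    have "((\<lambda>y. (cmod y)\<^sup>2) has_derivative (\<lambda>h. 2 * (y \<bullet> h))) (at y)"
      unfolding power2_norm_eq_inner
      by (rule has_derivative_eq_rhs[OF has_derivative_inner[OF has_derivative_ident has_derivative_ident]])
        (auto simp: inner_commute)
    from has_derivative_compose[OF this \<kappa>(1)[unfolded has_field_derivative_def]]
    show ?thesis .
  qed
  have supp\<kappa>: "\<kappa> ((cmod y)\<^sup>2) = 0" if "y \<notin> K'" for y
    using that \<kappa>(2) by (auto simp: K'_def)
  show ?thesis
    using dbar_integral_eq_0[OF L(1) K open_ball K' K'b g[unfolded \<Omega>_def] du bd supp d\<kappa> supp\<kappa>]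
    by (simp add: D_def \<Omega>_def mult.assoc)
qed

text \<open>Applies the compactly supported version to \<open>X\<close> times a cutoff and passes to
  the limit. As X 1 = 0, the mean value inequality gives |X s| \<le> MX (1 - s), which offsets the
  growth of the cutoff's derivative. All integrands are thus dominated by a constant times |g|,
  integrable because \<Omega> is bounded.\<close>

lemma radial_orthogonality:
  fixes X X' :: "real \<Rightarrow> real"
  assumes X: "\<And>s. (X has_real_derivative X' s) (at s)" "continuous_on UNIV X'"
    and inner: "\<And>s. s \<le> 1/4 \<Longrightarrow> X s = 0" "\<And>s. s \<le> 1/4 \<Longrightarrow> X' s = 0"
    and X1: "X 1 = 0"
    and g: "g \<in> bergman_space \<Omega>"
  shows "(LINT z|lebesgue_on \<Omega>. of_real (X' (N (fst z))) * cnj (deriv \<phi> (fst z)) * g z) = 0"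
proof -
  have gh: "holomorphic2_on g \<Omega>" and gL: "g \<in> L2 \<Omega>"
    using g by (auto simp: bergman_space_def)
  have \<Omega>: "open \<Omega>" "bounded \<Omega>"
    using L by (auto simp: \<Omega>_def open_Times bounded_Times)
  obtain \<rho> \<rho>' C where \<rho>: "\<And>n. times_differentiable_on n UNIV \<rho>'"
    "\<And>x. (\<rho> has_real_derivative \<rho>' x) (at x)"
    "\<And>x. 0 \<le> \<rho> x" "\<And>x. \<rho> x \<le> 1"
    "\<And>x. x \<le> 1 \<Longrightarrow> \<rho> x = 0" "\<And>x. x \<ge> 2 \<Longrightarrow> \<rho> x = 1"
    "\<And>x. x \<le> 1 \<Longrightarrow> \<rho>' x = 0" "\<And>x. x \<ge> 2 \<Longrightarrow> \<rho>' x = 0"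
    "\<And>x. \<bar>x * \<rho>' x\<bar> \<le> C"
    by (rule smooth_step_exists) metis
  have cont\<rho>': "continuous_on UNIV \<rho>'"
    by (auto intro!: continuous_at_imp_continuous_on differentiable_imp_continuous_within
        times_differentiable_on_imp_differentiable[OF \<rho>(1)])
  have cont\<rho>: "continuous_on UNIV \<rho>" by (rule has_real_derivative_continuous_on[OF \<rho>(2)])
  have contX: "continuous_on UNIV X" by (rule has_real_derivative_continuous_on[OF X(1)])
  define k where "k n = real (Suc n)" for n
  have k: "k n > 0" "k n \<ge> 1" for n by (auto simp: k_def)
  \<comment> \<open>Equal to 1 for s \<le> 1 - 2/k and to 0 for s \<ge> 1 - 1/k. The same cutoff
    serves for |\<phi>|^2 and for the squared modulus of the second variable.\<close>
  define \<kappa> where "\<kappa> n s = \<rho> (k n * (1 - s))" for n s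
  define \<kappa>' where "\<kappa>' n s = - k n * \<rho>' (k n * (1 - s))" for n s
  have \<kappa>: "(\<kappa> n has_real_derivative \<kappa>' n s) (at s)" for n s
    unfolding \<kappa>_def[abs_def] \<kappa>'_def
    by (rule DERIV_cong[OF DERIV_chain2[OF \<rho>(2)]]) (auto intro!: derivative_eq_intros)
  define T where "T n s = X s * \<kappa> n s" for n s
  define T' where "T' n s = X' s * \<kappa> n s + X s * \<kappa>' n s" for n s
  have T: "(T n has_real_derivative T' n s) (at s)" for n s
    unfolding T_def[abs_def] T'_def
    by (rule DERIV_cong[OF DERIV_mult[OF X(1) \<kappa>]]) simp
  have cont\<kappa>: "continuous_on UNIV (\<kappa> n)" for n
    by (rule has_real_derivative_continuous_on[OF \<kappa>])
  have cont\<kappa>': "continuous_on UNIV (\<kappa>' n)" for n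
    unfolding \<kappa>'_def[abs_def] by (intro continuous_intros continuous_on_compose2[OF cont\<rho>']) auto
  have contT': "continuous_on UNIV (T' n)" for n
    unfolding T'_def[abs_def] by (intro continuous_intros cont\<kappa> cont\<kappa>' X(2) contX)
  have out: "k n * (1 - s) \<le> 1" if "s \<ge> 1 - 1 / k n" for n s
    using that k[of n] by (simp add: field_simps)
  define s where "s n z = of_real (T' n (N (fst z))) * cnj (deriv \<phi> (fst z)) *
      of_real (\<kappa> n ((cmod (snd z))\<^sup>2)) * g z" for n z
  have s0: "(LINT z|lebesgue_on \<Omega>. s n z) = 0" for n
    unfolding s_def
  proof (rule radial_orthogonality_compact[OF T contT' _ _ _ _ _ \<kappa> _ gh])
    show "1 - 1 / k n < 1" using k[of n] by simp
  qed (auto simp: T_def T'_def \<kappa>_def \<kappa>'_def inner out \<rho>)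
  obtain MX where MX: "0 \<le> MX" "\<And>s. 0 \<le> s \<Longrightarrow> s \<le> 1 \<Longrightarrow> \<bar>X' s\<bar> \<le> MX"
    using bounded_on_unit_interval[OF X(2)] by blast
  have Xb: "\<bar>X s\<bar> \<le> MX * (1 - s)" if s: "0 \<le> s" "s \<le> 1" for s
  proof -
    have "norm (X s - X 1) \<le> MX * norm (s - 1)"
      by (rule field_differentiable_bound[of "{0..1}" X X'])
        (use s X(1) MX in \<open>auto intro: has_field_derivative_at_within\<close>)
    then show ?thesis using s X1 by simp
  qed
  have C0: "0 \<le> C" using order_trans[OF abs_ge_zero \<rho>(9)[of 0]] .
  have T'b: "\<bar>T' n s\<bar> \<le> MX + MX * C" if s: "0 \<le> s" "s \<le> 1" for n s
  proof -
    have "\<bar>X' s * \<kappa> n s\<bar> \<le> MX * 1"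
      unfolding abs_mult \<kappa>_def using MX(2)[OF s] MX(1) \<rho>(3,4) by (intro mult_mono) auto
    moreover have "\<bar>X s * \<kappa>' n s\<bar> \<le> MX * C"
    proof -
      have "\<bar>X s * \<kappa>' n s\<bar> = \<bar>X s\<bar> * (k n * \<bar>\<rho>' (k n * (1 - s))\<bar>)"
        using k[of n] by (simp add: \<kappa>'_def abs_mult)
      also have "\<dots> \<le> (MX * (1 - s)) * (k n * \<bar>\<rho>' (k n * (1 - s))\<bar>)"
        using Xb[OF s] k[of n] by (intro mult_right_mono) auto
      also have "\<dots> = MX * \<bar>(k n * (1 - s)) * \<rho>' (k n * (1 - s))\<bar>"
        using s k[of n] by (simp add: abs_mult)
      also have "\<dots> \<le> MX * C"
        by (rule mult_left_mono[OF \<rho>(9) MX(1)])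
      finally show ?thesis .
    qed
    ultimately show ?thesis
      unfolding T'_def using abs_triangle_ineq[of "X' s * \<kappa> n s" "X s * \<kappa>' n s"] by linarith
  qed
  define f where "f z = of_real (X' (N (fst z))) * cnj (deriv \<phi> (fst z)) * g z" for z
  have contphi: "continuous_on \<Omega> (\<lambda>z. deriv \<phi> (fst z))"
    by (rule continuous_on_compose2[OF holomorphic_on_imp_continuous_on[OF holomorphic_deriv[OF \<phi> L(1)]]])
      (auto simp: \<Omega>_def intro!: continuous_intros)
  have contN: "continuous_on \<Omega> (\<lambda>z. N (fst z))"
    unfolding N_def
    by (intro continuous_intros continuous_on_compose2[OF holomorphic_on_imp_continuous_on[OF \<phi>]])
      (auto simp: \<Omega>_def)
  have contg: "continuous_on \<Omega> g" by (rule holomorphic2_on_continuous_on[OF gh])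
  have ms: "s n \<in> borel_measurable (lebesgue_on \<Omega>)" for n
    unfolding s_def[abs_def] using \<Omega>
    by (intro continuous_imp_measurable_on_sets_lebesgue continuous_intros contphi contg
        continuous_on_compose2[OF contT' contN] continuous_on_compose2[OF cont\<kappa>]) auto
  have mf: "f \<in> borel_measurable (lebesgue_on \<Omega>)"
    unfolding f_def[abs_def] using \<Omega>
    by (intro continuous_imp_measurable_on_sets_lebesgue continuous_intros contphi contg
        continuous_on_compose2[OF X(2) contN]) auto
  define w where "w z = (MX + MX * C) * B * cmod (g z)" for z
  have gi: "integrable (lebesgue_on \<Omega>) g"
    using L2_mult_integrable[OF bounded_continuous_L2[OF \<Omega> continuous_on_const[of _ 1], of 1] gL] by simp
  then have w: "integrable (lebesgue_on \<Omega>) w"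
    unfolding w_def[abs_def] by (intro integrable_mult_right integrable_norm) 
  have zO: "fst z \<in> L" "cmod (snd z) < 1" if "z \<in> \<Omega>" for z
    using that by (auto simp: \<Omega>_def)
  have bound: "norm (s n z) \<le> w z" if z: "z \<in> \<Omega>" for n z
  proof -
    have B0: "0 \<le> B" using B[OF zO(1)[OF z]] norm_ge_zero order_trans by blast
    have "norm (s n z) \<le> (MX + MX * C) * B * 1 * cmod (g z)"
      unfolding s_def norm_mult norm_of_real complex_mod_cnj
      using T'b[of "N (fst z)" n] N_bounds[of "fst z"] B[OF zO(1)[OF z]] zO(1)[OF z] MX(1) C0 B0 \<rho>(3,4)
      by (intro mult_mono) (auto simp: \<kappa>_def)
    then show ?thesis by (simp add: w_def)
  qed
  have lim: "(\<lambda>n. s n z) \<longlonglongrightarrow> f z" if z: "z \<in> \<Omega>" for z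
  proof -
    \<comment> \<open>At a fixed point of \<Omega> both cutoffs are eventually 1 with vanishing
      derivative, so the sequence of integrands is eventually constant.\<close>
    have ev: "\<forall>\<^sub>F n in sequentially. k n * (1 - t) > 2" if "t < 1" for t
    proof -
      have "filterlim (\<lambda>n. k n * (1 - t)) at_top sequentially"
        unfolding k_def using that
        by (intro filterlim_at_top_mult_tendsto_pos[OF tendsto_const]
            filterlim_compose[OF filterlim_real_sequentially filterlim_Suc]) auto
      then show ?thesis by (simp add: filterlim_at_top_dense)
    qed
    have "(cmod (snd z))\<^sup>2 < 1" using zO(2)[OF z] by (simp add: power_less_one_iff)
    from ev[OF this] ev[OF N_bounds(1)[OF zO(1)[OF z]]]
    have "\<forall>\<^sub>F n in sequentially. f z = s n z"
      by eventually_elim (simp add: s_def f_def T'_def \<kappa>_def \<kappa>'_def \<rho>)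
    then show ?thesis by (rule Lim_transform_eventually[OF tendsto_const])
  qed
  have "(\<lambda>n. LINT z|lebesgue_on \<Omega>. s n z) \<longlonglongrightarrow> (LINT z|lebesgue_on \<Omega>. f z)"
    by (rule integral_dominated_convergence[OF mf ms w]) (auto intro!: AE_I2 lim bound)
  then show ?thesis
    by (simp add: s0 LIMSEQ_const_iff f_def)
qed

end

section \<open>Blow-up at the corner\<close>

text \<open>Differentiating a holomorphic function of the first variable in the real direction
  \<open>(1, 0)\<close> is complex differentiation, so one repeated real direction captures the
  corner singularity.\<close>

lemma iter_partial_holomorphic_fst:
  assumes L: "open L" "open V" and G: "G holomorphic_on L"
    and f: "\<And>z. z \<in> L \<times> V \<Longrightarrow> f z = G (fst z)"
  shows "z \<in> L \<times> V \<Longrightarrow> iter_partial (replicate k (1, 0)) f z = (deriv ^^ k) G (fst z)"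
proof (induction k arbitrary: z)
  case 0
  then show ?case using f by simp
next
  case (Suc k)
  have d: "((deriv ^^ k) G has_field_derivative (deriv ^^ Suc k) G (fst z)) (at (fst z))"
    using holomorphic_derivI[OF holomorphic_higher_deriv[OF G L(1)] L(1), of "fst z" k] Suc.prems by auto
  have "((\<lambda>z. (deriv ^^ k) G (fst z)) has_derivative (\<lambda>h. (deriv ^^ Suc k) G (fst z) * fst h)) (at z)"
    by (rule has_derivative_compose[OF has_derivative_fst[OF has_derivative_ident]
        d[unfolded has_field_derivative_def]])
  then have "(iter_partial (replicate k (1, 0)) f has_derivative (\<lambda>h. (deriv ^^ Suc k) G (fst z) * fst h)) (at z)"
    by (rule has_derivative_transform_within_open[OF _ open_Times[OF L] Suc.prems])
      (use Suc.IH in auto)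
  from frechet_derivative_at[OF this] show ?case
    unfolding replicate_Suc iter_partial.simps by (metis fst_conv mult.right_neutral)
qed

text \<open>Testing with one bump function avoids identifying \<open>g\<close> with \<open>D\<close>
  almost everywhere. If I is the integral of the bump and Q that of |g|^2, the chain of estimates
  gives l I \<le> (l I + Q / l) / 2, hence l^2 I \<le> Q. The unit \<open>u\<close> rotates
  \<open>D\<close> so that its real part bounds it from below without cancellation.\<close>

lemma weak_derivative_L2_lower_bound:
  fixes \<Omega> :: "'a::euclidean_space set"
  assumes \<Omega>: "open \<Omega>" and g: "g \<in> L2 \<Omega>" and D: "continuous_on \<Omega> D"
    and eq: "\<And>\<phi>. \<phi> \<in> test_functions \<Omega> \<Longrightarrow>
      (LINT x|lebesgue_on \<Omega>. \<phi> x *\<^sub>R g x) = (LINT x|lebesgue_on \<Omega>. \<phi> x *\<^sub>R D x)"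
    and r: "0 < r" "cball p r \<subseteq> \<Omega>"
    and u: "cmod u = 1" and l: "0 < l" "\<And>x. x \<in> cball p r \<Longrightarrow> l \<le> Re (u * D x)"
  shows "l\<^sup>2 * measure lborel (ball p (r / 2)) \<le> (LINT x|lebesgue_on \<Omega>. (cmod (g x))\<^sup>2)"
proof -
  obtain \<rho> :: "real \<Rightarrow> real" where \<rho>: "\<And>n. times_differentiable_on n UNIV \<rho>"
    "\<And>x. 0 \<le> \<rho> x" "\<And>x. \<rho> x \<le> 1"
    "\<And>x. x \<le> 1 \<Longrightarrow> \<rho> x = 0" "\<And>x. x \<ge> 2 \<Longrightarrow> \<rho> x = 1"
    by (rule smooth_step_exists) metis
  \<comment> \<open>The argument 3 - 2 |x - p|^2 / r^2 is at most 1 off the ball of radius r and at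
    least 2 on the ball of radius r / 2. The squared norm keeps it smooth at
    \<open>p\<close>.\<close>
  define \<phi> where "\<phi> x = \<rho> (3 + (- 2 / r\<^sup>2) * ((x + - p) \<bullet> (x + - p)))" for x
  have smooth: "smooth_on UNIV \<phi>"
  proof (rule smooth_onI)
    fix n
    have lin: "times_differentiable_on n UNIV (\<lambda>x. x + - p)"
      by (intro times_differentiable_on_add times_differentiable_on_bounded_linear
          bounded_linear_ident times_differentiable_on_const)
    show "times_differentiable_on n UNIV \<phi>"
      unfolding \<phi>_def[abs_def]
      by (intro times_differentiable_on_compose_real[OF \<rho>(1)]
          times_differentiable_on_add[OF times_differentiable_on_const]
          times_differentiable_on_bilinear[OF bounded_bilinear_mult times_differentiable_on_const]
          times_differentiable_on_bilinear[OF bounded_bilinear_inner lin lin]) auto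
  qed auto
  have arg: "(x + - p) \<bullet> (x + - p) = (dist p x)\<^sup>2" for x
    by (subst dist_commute) (simp add: dist_norm power2_norm_eq_inner)
  have out: "\<phi> x = 0" if "x \<notin> ball p r" for x
  proof -
    have "r\<^sup>2 \<le> (dist p x)\<^sup>2" using that r by (intro power_mono) auto
    then have "3 + (- 2 / r\<^sup>2) * (dist p x)\<^sup>2 \<le> 1" using r by (simp add: field_simps)
    then show ?thesis unfolding \<phi>_def arg by (rule \<rho>(4))
  qed
  have inn: "\<phi> x = 1" if "x \<in> ball p (r / 2)" for x
  proof -
    have "(dist p x)\<^sup>2 \<le> (r / 2)\<^sup>2" using that r by (intro power_mono) auto
    also have "\<dots> \<le> r\<^sup>2 / 2" by (simp add: power_divide)
    finally have "2 \<le> 3 + (- 2 / r\<^sup>2) * (dist p x)\<^sup>2" using r by (simp add: field_simps)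
    then show ?thesis unfolding \<phi>_def arg by (rule \<rho>(5))
  qed
  have \<phi>01: "0 \<le> \<phi> x" "\<phi> x \<le> 1" for x by (auto simp: \<phi>_def \<rho>)
  have "{x. \<phi> x \<noteq> 0} \<subseteq> cball p r" using out by force
  then have cl: "closure {x. \<phi> x \<noteq> 0} \<subseteq> cball p r" by (simp add: closure_minimal)
  then have "compact (closure {x. \<phi> x \<noteq> 0})"
    by (meson bounded_cball bounded_subset closed_closure compact_eq_bounded_closed)
  then have test: "\<phi> \<in> test_functions \<Omega>"
    using smooth cl r by (auto simp: test_functions_def)
  have cont: "continuous_on \<Omega> \<phi>"
    using smooth_on_imp_continuous_on[OF smooth] continuous_on_subset by blast
  have z: "\<phi> x = 0" if "x \<in> \<Omega> - cball p r" for x using out that by auto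
  note cs = lebesgue_on_integral_compact_support[OF \<Omega> compact_cball r(2)]
  have i\<phi>: "integrable (lebesgue_on \<Omega>) \<phi>" by (rule cs(2)[OF cont z])
  have iD: "integrable (lebesgue_on \<Omega>) (\<lambda>x. \<phi> x *\<^sub>R D x)"
    by (rule cs(2)) (auto intro!: continuous_intros cont D simp: z)
  have iuD: "integrable (lebesgue_on \<Omega>) (\<lambda>x. \<phi> x * Re (u * D x))"
    by (rule cs(2)) (auto intro!: continuous_intros cont D simp: z)
  define I where "I = (LINT x|lebesgue_on \<Omega>. \<phi> x)"
  define Q where "Q = (LINT x|lebesgue_on \<Omega>. (cmod (g x))\<^sup>2)"
  have ig2: "integrable (lebesgue_on \<Omega>) (\<lambda>x. (cmod (g x))\<^sup>2)" and mg: "g \<in> borel_measurable (lebesgue_on \<Omega>)"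
    using g by (auto simp: L2_def)
  have meas: "measure lborel (ball p (r / 2)) \<le> I"
  proof -
    have "I = (LINT x|lborel. (if x \<in> \<Omega> then \<phi> x else 0))"
      unfolding I_def by (rule cs(3)[OF cont z])
    moreover have "(LINT x|lborel. indicator (ball p (r / 2)) x) \<le> \<dots>"
    proof (rule integral_mono)
      show "integrable lborel (indicator (ball p (r / 2)) :: 'a \<Rightarrow> real)"
        using emeasure_bounded_finite[OF bounded_ball] by (intro integrable_real_indicator) simp_all
      show "integrable lborel (\<lambda>x. if x \<in> \<Omega> then \<phi> x else 0)" by (rule cs(1)[OF cont z])
      have "ball p (r / 2) \<subseteq> \<Omega>"
        using r by (intro order_trans[OF _ r(2)]) auto
      then show "indicator (ball p (r / 2)) x \<le> (if x \<in> \<Omega> then \<phi> x else 0)" for x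
        using inn \<phi>01 by (auto simp: indicator_def)
    qed
    ultimately show ?thesis by simp
  qed
  \<comment> \<open>The inequality 2ab \<le> a^2 + b^2 with weight \<open>l\<close>, using that the
    square of the bump is at most the bump because its values lie in [0, 1].\<close>
  define w where "w x = (l * \<phi> x + (cmod (g x))\<^sup>2 / l) / 2" for x
  have iw: "integrable (lebesgue_on \<Omega>) w"
    unfolding w_def[abs_def]
    by (intro integrable_divide Bochner_Integration.integrable_add integrable_mult_right i\<phi> ig2)
  have wb: "cmod (\<phi> x *\<^sub>R g x) \<le> w x" for x
  proof -
    have "2 * (l * \<phi> x) * cmod (g x) \<le> (l * \<phi> x)\<^sup>2 + (cmod (g x))\<^sup>2"
      using sum_squares_bound[of "l * \<phi> x" "cmod (g x)"] by (simp add: mult.assoc)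
    also have "(l * \<phi> x)\<^sup>2 \<le> l\<^sup>2 * \<phi> x"
      unfolding power_mult_distrib using \<phi>01[of x] by (intro mult_left_mono) (auto simp: power2_eq_square mult_left_le)
    finally show ?thesis
      using l(1) \<phi>01(1)[of x] unfolding w_def by (simp add: field_simps power2_eq_square)
  qed
  have i\<phi>g: "integrable (lebesgue_on \<Omega>) (\<lambda>x. \<phi> x *\<^sub>R g x)"
  proof (rule Bochner_Integration.integrable_bound[OF iw])
    show "(\<lambda>x. \<phi> x *\<^sub>R g x) \<in> borel_measurable (lebesgue_on \<Omega>)"
      using i\<phi> mg by (intro borel_measurable_scaleR) auto
    show "AE x in lebesgue_on \<Omega>. norm (\<phi> x *\<^sub>R g x) \<le> norm (w x)"
      using wb by (intro AE_I2) (auto intro: order_trans[OF _ abs_ge_self])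
  qed
  have "l * I = (LINT x|lebesgue_on \<Omega>. l * \<phi> x)"
    by (simp add: I_def)
  also have "\<dots> \<le> (LINT x|lebesgue_on \<Omega>. \<phi> x * Re (u * D x))"
  proof (rule integral_mono[OF _ iuD])
    show "l * \<phi> x \<le> \<phi> x * Re (u * D x)" for x
    proof (cases "x \<in> cball p r")
      case True
      then show ?thesis
        using mult_left_mono[OF l(2)[of x] \<phi>01(1)[of x]] by (simp only: mult.commute[of l])
    qed (use out[of x] in auto)
  qed (use i\<phi> in simp)
  also have "\<dots> = (LINT x|lebesgue_on \<Omega>. Re (u * (\<phi> x *\<^sub>R D x)))"
    by (rule Bochner_Integration.integral_cong) (auto simp: algebra_simps)
  also have "\<dots> = Re (LINT x|lebesgue_on \<Omega>. u * (\<phi> x *\<^sub>R D x))"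
    by (intro integral_Re integrable_mult_right iD)
  also have "\<dots> = Re (u * (LINT x|lebesgue_on \<Omega>. \<phi> x *\<^sub>R g x))"
    unfolding eq[OF test] integral_mult_right_zero ..
  also have "\<dots> \<le> cmod (LINT x|lebesgue_on \<Omega>. \<phi> x *\<^sub>R g x)"
    by (rule order_trans[OF complex_Re_le_cmod]) (simp add: norm_mult u)
  also have "\<dots> \<le> (LINT x|lebesgue_on \<Omega>. cmod (\<phi> x *\<^sub>R g x))"
    by (rule integral_norm_bound)
  also have "\<dots> \<le> (LINT x|lebesgue_on \<Omega>. w x)"
    by (rule integral_mono[OF integrable_norm[OF i\<phi>g] iw wb])
  also have "\<dots> = (l * I + Q / l) / 2"
    unfolding w_def I_def Q_def using i\<phi> ig2 by simp
  finally have avg: "l * I \<le> (l * I + Q / l) / 2" .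
  have "a \<le> b" if "a \<le> (a + b) / 2" for a b :: real
    using that by simp
  from this[OF avg] have "l * I \<le> Q / l" .
  then have "l\<^sup>2 * I \<le> Q" using l(1) by (simp add: field_simps power2_eq_square)
  moreover have "l\<^sup>2 * measure lborel (ball p (r / 2)) \<le> l\<^sup>2 * I"
    by (intro mult_left_mono meas) simp
  ultimately show ?thesis by (simp add: Q_def)
qed

lemma lens_map'_holomorphic: "lens_map' holomorphic_on lens"
  using holomorphic_deriv[OF lens_map_holomorphic lens_open] deriv_lens_map
  by (simp cong: holomorphic_cong)

text \<open>
  Near the corner, \<open>p = lens_p z\<close> is a local coordinate on the double cover in which \<open>lens_map'\<close> is
  holomorphic with a simple zero, and \<open>d/dz = - 1 / (2p) d/dp\<close>.
\<close>

lemma lens_map'_higher_deriv: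
  obtains e where "0 < e" "\<And>k. \<exists>R. R holomorphic_on ball 0 e \<and> R 0 \<noteq> 0 \<and>
    (\<forall>z\<in>lens. cmod (corner - z) < e\<^sup>2 \<longrightarrow>
      (deriv ^^ k) lens_map' z = lens_p z * R (lens_p z) / lens_p z ^ (2 * k))"
proof -
  define d where "d = corner - cnj corner"
  have d: "Re d = 0" "Im d = sqrt 3" by (auto simp: d_def corner_def)
  have d0: "d \<noteq> 0" using d by (auto simp: complex_eq_iff)
  define q where "q p = csqrt (d - p\<^sup>2)" for p
  \<comment> \<open>The imaginary part of \<open>d - p\<^sup>2\<close> exceeds sqrt 3 - 1 > 0 when
    |p| < 1.\<close>
  have br: "d - p\<^sup>2 \<notin> \<real>\<^sub>\<le>\<^sub>0" if "cmod p < 1" for p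
  proof -
    have "cmod (p\<^sup>2) < 1" using that by (simp add: norm_power power_less_one_iff)
    then have "Im (p\<^sup>2) < 1" using abs_Im_le_cmod[of "p\<^sup>2"] by linarith
    moreover have "1 < sqrt (3::real)" by simp
    ultimately have "0 < Im (d - p\<^sup>2)" unfolding minus_complex.sel d by linarith
    then show ?thesis by (auto simp: complex_nonpos_Reals_iff)
  qed
  have "isCont (\<lambda>p. p ^ 3 + q p ^ 3) 0"
    unfolding q_def using br[of 0] by (intro continuous_intros isCont_csqrt') auto
  moreover have "(0::complex) ^ 3 + q 0 ^ 3 \<noteq> 0" using d0 by (simp add: q_def)
  ultimately obtain e0 where e0: "e0 > 0" "\<And>p. dist 0 p < e0 \<Longrightarrow> p ^ 3 + q p ^ 3 \<noteq> 0"
    using continuous_at_avoid[of 0 "\<lambda>p. p ^ 3 + q p ^ 3" 0] by blast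
  define e where "e = min e0 1"
  have e: "0 < e" "e \<le> 1" "e \<le> e0" using e0 by (auto simp: e_def)
  have pb: "lens_p z \<in> ball 0 e" if "cmod (corner - z) < e\<^sup>2" for z
  proof -
    have "(cmod (lens_p z))\<^sup>2 < e\<^sup>2" using that by (simp add: lens_p_def)
    then show ?thesis using e(1) by (simp add: power2_less_imp_less)
  qed
  have "\<exists>R. R holomorphic_on ball 0 e \<and> R 0 \<noteq> 0 \<and>
    (\<forall>z\<in>lens. cmod (corner - z) < e\<^sup>2 \<longrightarrow>
      (deriv ^^ k) lens_map' z = lens_p z * R (lens_p z) / lens_p z ^ (2 * k))" for k
  proof (induction k)
    case 0
    define R where "R p = - 3 * d * q p / (p ^ 3 + q p ^ 3)\<^sup>2" for p
    have qh: "q holomorphic_on ball 0 e"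
      unfolding q_def[abs_def] using br e
      by (intro holomorphic_on_compose_gen[OF _ holomorphic_on_csqrt, unfolded o_def] holomorphic_intros) auto
    have "R holomorphic_on ball 0 e"
      unfolding R_def[abs_def] using e0(2) e by (intro holomorphic_intros qh) auto
    moreover have "R 0 \<noteq> 0" using d0 by (simp add: R_def q_def)
    moreover have "lens_map' z = lens_p z * R (lens_p z)" for z
    proof -
      have "q (lens_p z) = lens_q z"
        unfolding q_def lens_q_def d_def by (simp add: lens_p_def)
      then show ?thesis by (simp add: lens_map'_def R_def d_def)
    qed
    ultimately show ?case by auto
  next
    case (Suc k)
    then obtain R where R: "R holomorphic_on ball 0 e" "R 0 \<noteq> 0"
      "\<And>z. z \<in> lens \<Longrightarrow> cmod (corner - z) < e\<^sup>2 \<Longrightarrow>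
        (deriv ^^ k) lens_map' z = lens_p z * R (lens_p z) / lens_p z ^ (2 * k)"
      by blast
    \<comment> \<open>This is -1/(2p) d/dp applied to p^(1 - 2k) R(p), with the factor p^(-1 - 2k)
      taken out. The ball on which \<open>R\<close> is holomorphic stays the same for every
      order.\<close>
    define S where "S p = - (1/2) * ((1 - 2 * of_nat k) * R p + p * deriv R p)" for p
    have "S holomorphic_on ball 0 e"
      unfolding S_def[abs_def] by (intro holomorphic_intros R(1) holomorphic_deriv) auto
    moreover have "S 0 \<noteq> 0"
    proof -
      \<comment> \<open>The exponent 1 - 2k is odd, so differentiation never annihilates the leading
        term: the half-integer power at the corner persists at every order.\<close>
      have "(1 - 2 * int k) \<noteq> 0" by presburger
      then have "of_int (1 - 2 * int k) \<noteq> (0::complex)" by (simp only: of_int_eq_0_iff not_False_eq_True)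
      then show ?thesis using R(2) by (simp add: S_def)
    qed
    moreover have "(deriv ^^ Suc k) lens_map' z = lens_p z * S (lens_p z) / lens_p z ^ (2 * Suc k)"
      if z: "z \<in> lens" "cmod (corner - z) < e\<^sup>2" for z
    proof -
      define P where "P = lens_p z"
      have P: "P \<noteq> 0" using lens_p_q_nonzero(1)[OF z(1)] by (simp add: P_def)
      have dR: "((\<lambda>z. R (lens_p z)) has_field_derivative deriv R P * (- 1 / (2 * P))) (at z)"
        unfolding P_def
        by (rule DERIV_chain2[OF holomorphic_derivI[OF R(1)] lens_p_has_derivative]) (use pb z in auto)
      have dP: "(lens_p has_field_derivative - 1 / (2 * P)) (at z)"
        unfolding P_def by (rule lens_p_has_derivative[OF z(1)])
      have dk: "((\<lambda>z. lens_p z ^ (2 * k)) has_field_derivative of_nat (2 * k) * P ^ (2 * k - 1) * (- 1 / (2 * P))) (at z)"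
        using DERIV_power[OF dP, of "2 * k"] by (simp add: P_def mult_ac)
      have "((\<lambda>z. lens_p z * R (lens_p z) / lens_p z ^ (2 * k)) has_field_derivative
          (((- 1 / (2 * P)) * R P + (deriv R P * (- 1 / (2 * P))) * P) * P ^ (2 * k) -
            P * R P * (of_nat (2 * k) * P ^ (2 * k - 1) * (- 1 / (2 * P)))) / (P ^ (2 * k) * P ^ (2 * k))) (at z)"
        using DERIV_divide[OF DERIV_mult[OF dP dR] dk] P by (simp add: P_def)
      also have "(((- 1 / (2 * P)) * R P + (deriv R P * (- 1 / (2 * P))) * P) * P ^ (2 * k) -
            P * R P * (of_nat (2 * k) * P ^ (2 * k - 1) * (- 1 / (2 * P)))) / (P ^ (2 * k) * P ^ (2 * k)) =
          P * S P / P ^ (2 * Suc k)"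
      proof -
        have pk: "P * (of_nat (2 * k) * P ^ (2 * k - 1)) = of_nat (2 * k) * P ^ (2 * k)"
          by (cases k) auto
        have "((- 1 / (2 * P)) * R P + (deriv R P * (- 1 / (2 * P))) * P) * P ^ (2 * k) -
            P * R P * (of_nat (2 * k) * P ^ (2 * k - 1) * (- 1 / (2 * P))) =
            ((- 1 / (2 * P)) * R P + (deriv R P * (- 1 / (2 * P))) * P) * P ^ (2 * k) -
            (P * (of_nat (2 * k) * P ^ (2 * k - 1))) * R P * (- 1 / (2 * P))"
          by (simp only: mult_ac)
        also have "\<dots> = (S P / P) * P ^ (2 * k)"
          unfolding pk S_def using P by (simp add: field_simps)
        finally show ?thesis
          using P by (simp add: power2_eq_square)
      qed
      finally have "((deriv ^^ k) lens_map' has_field_derivative P * S P / P ^ (2 * Suc k)) (at z)"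
      proof (rule has_field_derivative_transform_within_open)
        show "open (lens \<inter> ball corner (e\<^sup>2))" using lens_open by auto
        show "z \<in> lens \<inter> ball corner (e\<^sup>2)" using z by (simp add: dist_norm)
      qed (simp add: R(3) dist_norm)
      then show ?thesis by (simp add: DERIV_imp_deriv P_def)
    qed
    ultimately show ?case by blast
  qed
  then show ?thesis using that e(1) by blast
qed

text \<open>Writing x = corner - s^2 \<zeta> with \<zeta> near i gives p = s csqrt \<zeta>, so the
  third derivative R(p) / p^5 is s^(-5) times a function of (s, \<zeta>) that is continuous and
  nonzero at (0, i). One rotation therefore works on all these balls. The points with \<zeta> = i
  descend vertically from the corner into the lens.\<close>

lemma third_deriv_blowup:
  obtains u c e where "cmod u = 1" "0 < c" "0 < e" "e \<le> 1/4"
    "\<And>s x. 0 < s \<Longrightarrow> s < e \<Longrightarrow> dist (corner - \<i> * (of_real s)\<^sup>2) x \<le> e * s\<^sup>2 \<Longrightarrow>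
      x \<in> lens \<and> c / s ^ 5 \<le> Re (u * (deriv ^^ 3) lens_map' x)"
proof -
  obtain e0 where e0: "0 < e0" "\<And>k. \<exists>R. R holomorphic_on ball 0 e0 \<and> R 0 \<noteq> 0 \<and>
    (\<forall>z\<in>lens. cmod (corner - z) < e0\<^sup>2 \<longrightarrow>
      (deriv ^^ k) lens_map' z = lens_p z * R (lens_p z) / lens_p z ^ (2 * k))"
    by (rule lens_map'_higher_deriv) blast
  obtain R where R: "R holomorphic_on ball 0 e0" "R 0 \<noteq> 0"
    "\<And>z. z \<in> lens \<Longrightarrow> cmod (corner - z) < e0\<^sup>2 \<Longrightarrow>
      (deriv ^^ 3) lens_map' z = lens_p z * R (lens_p z) / lens_p z ^ 6"
    using e0(2)[of 3] by auto
  define V where "V y = R (of_real (fst y) * csqrt (snd y)) / csqrt (snd y) ^ 5" for y :: "real \<times> complex"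
  define w where "w = V (0, \<i>)"
  have w0: "w \<noteq> 0" using R(2) by (simp add: w_def V_def del: csqrt_ii)
  \<comment> \<open>The phase that turns the limiting value \<open>w\<close> into the positive
    number |w|.\<close>
  define u where "u = cnj w / cmod w"
  have u: "cmod u = 1" using w0 by (simp add: u_def norm_divide)
  have uw: "u * w = cmod w"
  proof -
    have "u * w = w * cnj w / of_real (cmod w)" by (simp add: u_def)
    also have "\<dots> = (of_real (cmod w))\<^sup>2 / of_real (cmod w)" by (simp only: of_real_power[symmetric] complex_norm_square)
    finally show ?thesis using w0 by (simp add: power2_eq_square)
  qed
  have "isCont R 0"
    using R(1) e0(1) by (auto simp: continuous_on_eq_continuous_at dest!: holomorphic_on_imp_continuous_on)
  then have Rc: "isCont R (of_real (fst (0::real, \<i>)) * csqrt (snd (0::real, \<i>)))" by simp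
  have cs: "isCont (\<lambda>y::real \<times> complex. csqrt (snd y)) (0, \<i>)"
    by (intro isCont_csqrt' continuous_intros) (auto simp: complex_nonpos_Reals_iff)
  have "isCont (\<lambda>y::real \<times> complex. of_real (fst y) * csqrt (snd y)) (0, \<i>)"
    by (intro continuous_intros cs)
  then have "isCont (\<lambda>y::real \<times> complex. R (of_real (fst y) * csqrt (snd y))) (0, \<i>)"
    by (rule isCont_o2) (rule Rc)
  then have "isCont V (0, \<i>)"
    unfolding V_def[abs_def] by (intro continuous_intros cs) (auto simp del: csqrt_ii)
  then have "((\<lambda>y. Re (u * V y)) \<longlongrightarrow> Re (u * V (0, \<i>))) (nhds (0, \<i>))"
    unfolding isCont_def tendsto_at_iff_tendsto_nhds by (intro tendsto_intros)
  moreover have "cmod w / 2 < Re (u * V (0, \<i>))"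
    using w0 unfolding w_def[symmetric] uw by simp
  ultimately have "\<forall>\<^sub>F y in nhds (0, \<i>). cmod w / 2 < Re (u * V y)"
    by (rule order_tendstoD)
  then obtain d where d: "d > 0" "\<And>y. dist y (0, \<i>) < d \<Longrightarrow> cmod w / 2 < Re (u * V y)"
    unfolding eventually_nhds_metric by blast
  \<comment> \<open>The bound 1/4 keeps the balls inside the lens, d/2 makes |s| + |\<zeta> - i| <
    d, and e0/2 gives |corner - x| \<le> (5/16) e0^2 < e0^2.\<close>
  define e where "e = min (1/4) (min (d/2) (e0/2))"
  have e: "0 < e" "e \<le> 1/4" "e \<le> d/2" "e \<le> e0/2" using d e0 by (auto simp: e_def)
  show ?thesis
  proof (rule that[OF u _ e(1,2), of "cmod w / 2"])
    show "0 < cmod w / 2" using w0 by simp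
    fix s :: real and x
    assume s: "0 < s" "s < e" and x: "dist (corner - \<i> * (of_real s)\<^sup>2) x \<le> e * s\<^sup>2"
    define \<zeta> where "\<zeta> = (corner - x) / (of_real s)\<^sup>2"
    have xz: "x = corner - (of_real s)\<^sup>2 * \<zeta>" using s by (simp add: \<zeta>_def)
    have "dist (corner - \<i> * (of_real s)\<^sup>2) x = cmod ((of_real s)\<^sup>2 * (\<zeta> - \<i>))"
      unfolding xz dist_norm by (simp add: algebra_simps)
    also have "\<dots> = s\<^sup>2 * cmod (\<zeta> - \<i>)" by (simp add: norm_mult norm_power)
    finally have "s\<^sup>2 * cmod (\<zeta> - \<i>) \<le> s\<^sup>2 * e" using x by (simp add: mult.commute)
    then have ze: "cmod (\<zeta> - \<i>) \<le> e" using s by simp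
    have z1: "\<bar>Re \<zeta>\<bar> \<le> 1/4" "3/4 \<le> Im \<zeta>"
      using abs_Re_le_cmod[of "\<zeta> - \<i>"] abs_Im_le_cmod[of "\<zeta> - \<i>"] ze e(2) by auto
    have zn: "cmod \<zeta> \<le> 5/4"
      using norm_triangle_ineq2[of \<zeta> \<i>] ze e(2) by simp
    have s2: "0 < s\<^sup>2" "s\<^sup>2 \<le> 1/16"
      using s e(2) power_mono[of s "1/4" 2] by (auto simp: power2_eq_square)
    have zn2: "(Re \<zeta>)\<^sup>2 + (Im \<zeta>)\<^sup>2 \<le> 25/16"
      using power_mono[OF zn norm_ge_zero, of 2] unfolding cmod_power2 by (simp add: power2_eq_square)
    have s3: "1 < sqrt (3::real)" by simp
    \<comment> \<open>Exactly the condition, after division by s^2, for x to lie in both discs: the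
      left side is at most 25/256 and the right side at least 3/4 - 1/4.\<close>
    have small: "s\<^sup>2 * ((Re \<zeta>)\<^sup>2 + (Im \<zeta>)\<^sup>2) < sqrt 3 * Im \<zeta> - \<bar>Re \<zeta>\<bar>"
    proof -
      have "s\<^sup>2 * ((Re \<zeta>)\<^sup>2 + (Im \<zeta>)\<^sup>2) \<le> (1/16) * (25/16)"
        using s2 zn2 by (intro mult_mono) auto
      moreover have "1 * (3/4) \<le> sqrt 3 * Im \<zeta>"
        using s3 z1 by (intro mult_mono) auto
      ultimately show ?thesis using z1 by linarith
    qed
    have rx: "Re x = 1/2 - s\<^sup>2 * Re \<zeta>" "Im x = sqrt 3 / 2 - s\<^sup>2 * Im \<zeta>"
      unfolding xz by (auto simp: corner_def simp flip: of_real_power)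
    have nx: "(Re x)\<^sup>2 + (Im x)\<^sup>2 = 1 + s\<^sup>2 * (s\<^sup>2 * ((Re \<zeta>)\<^sup>2 + (Im \<zeta>)\<^sup>2) - sqrt 3 * Im \<zeta> - Re \<zeta>)"
      "(Re x - 1)\<^sup>2 + (Im x)\<^sup>2 = 1 + s\<^sup>2 * (s\<^sup>2 * ((Re \<zeta>)\<^sup>2 + (Im \<zeta>)\<^sup>2) - sqrt 3 * Im \<zeta> + Re \<zeta>)"
      unfolding rx by (simp_all add: power2_eq_square algebra_simps)
    have xl: "x \<in> lens"
      unfolding mem_lens_iff nx using small s2 by (auto simp: mult_less_0_iff abs_if split: if_splits)
    have "cmod (corner - x) = s\<^sup>2 * cmod \<zeta>"
      unfolding xz by (simp add: norm_mult norm_power)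
    also have "\<dots> \<le> (e0/2)\<^sup>2 * (5/4)"
      using s e zn by (intro mult_mono power_mono) auto
    also have "\<dots> < e0\<^sup>2" using e0(1) by (simp add: power2_eq_square)
    finally have near: "cmod (corner - x) < e0\<^sup>2" .
    have Rep: "0 < Re (csqrt \<zeta>)"
      using csqrt_principal[of \<zeta>] z1(2) Im_csqrt_eq_0_iff power2_csqrt[of \<zeta>]
      by (metis Im_power2 less_numeral_extra(3) linorder_not_less mult_zero_left mult_zero_right order_less_le_trans zero_less_divide_iff zero_less_numeral)
    have px: "lens_p x = of_real s * csqrt \<zeta>"
      unfolding lens_p_def
    proof (rule csqrt_unique)
      show "(of_real s * csqrt \<zeta>)\<^sup>2 = corner - x"
        unfolding power_mult_distrib power2_csqrt by (simp add: xz)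
      show "0 < Re (of_real s * csqrt \<zeta>) \<or> Re (of_real s * csqrt \<zeta>) = 0 \<and> 0 \<le> Im (of_real s * csqrt \<zeta>)"
        using Rep s(1) by (simp del: csqrt.sel)
    qed
    have z0: "csqrt \<zeta> \<noteq> 0" using Rep by (metis order_less_irrefl zero_complex.sel(1))
    have "(deriv ^^ 3) lens_map' x = V (s, \<zeta>) / of_real (s ^ 5)"
      unfolding R(3)[OF xl near] px V_def using z0 s(1) by (simp add: power_mult_distrib field_simps eval_nat_numeral del: csqrt_eq_0)
    then have "Re (u * (deriv ^^ 3) lens_map' x) = Re (u * V (s, \<zeta>)) / s ^ 5"
      by (simp only: times_divide_eq_right Re_divide_of_real)
    moreover have "cmod w / 2 < Re (u * V (s, \<zeta>))"
    proof (rule d(2))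
      have "dist (s, \<zeta>) (0, \<i>) \<le> \<bar>s\<bar> + cmod (\<zeta> - \<i>)"
        unfolding dist_Pair_Pair by (rule order_trans[OF sqrt_sum_squares_le_sum_abs]) (simp add: dist_norm)
      also have "\<dots> < d" using s ze e(3) by auto
      finally show "dist (s, \<zeta>) (0, \<i>) < d" .
    qed
    then have "cmod w / 2 / s ^ 5 \<le> Re (u * V (s, \<zeta>)) / s ^ 5"
      using s(1) by (intro divide_right_mono) auto
    ultimately show "x \<in> lens \<and> cmod w / 2 / s ^ 5 \<le> Re (u * (deriv ^^ 3) lens_map' x)"
      using xl by (simp only: simp_thms)
  qed
qed

section \<open>The Bergman projection\<close>

text \<open>Exhibiting one candidate determines the projection: the difference of two candidates
  lies in the Bergman space and is orthogonal to itself, so it vanishes almost everywhere, and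
  everywhere on \<Omega> by continuity. The value 0 prescribed off \<Omega> settles the remaining
  points.\<close>

lemma bergman_projection_eqI:
  assumes \<Omega>: "open \<Omega>" and f: "f \<in> L2 \<Omega>"
    and h: "h \<in> bergman_space \<Omega>" "\<And>z. z \<notin> \<Omega> \<Longrightarrow> h z = 0"
    and orth: "\<And>g. g \<in> bergman_space \<Omega> \<Longrightarrow> L2_inner \<Omega> (\<lambda>z. f z - h z) g = 0"
  shows "bergman_projection \<Omega> f = h"
  unfolding bergman_projection_def
proof (rule the_equality)
  show "h \<in> bergman_space \<Omega> \<and> (\<forall>z. z \<notin> \<Omega> \<longrightarrow> h z = 0) \<and>
     (\<forall>g \<in> bergman_space \<Omega>. L2_inner \<Omega> (\<lambda>z. f z - h z) g = 0)"
    using h orth by blast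
next
  fix k assume k: "k \<in> bergman_space \<Omega> \<and> (\<forall>z. z \<notin> \<Omega> \<longrightarrow> k z = 0) \<and>
     (\<forall>g \<in> bergman_space \<Omega>. L2_inner \<Omega> (\<lambda>z. f z - k z) g = 0)"
  define d where "d z = k z - h z" for z
  have hk: "h \<in> L2 \<Omega>" "k \<in> L2 \<Omega>" "holomorphic2_on h \<Omega>" "holomorphic2_on k \<Omega>"
    using h k by (auto simp: bergman_space_def)
  have "holomorphic2_on d \<Omega>"
    unfolding holomorphic2_on_def
  proof
    fix z assume z: "z \<in> \<Omega>"
    obtain a b where 1: "(k has_derivative (\<lambda>h. a * fst h + b * snd h)) (at z)"
      using hk(4) z unfolding holomorphic2_on_def by blast
    obtain a' b' where 2: "(h has_derivative (\<lambda>h. a' * fst h + b' * snd h)) (at z)"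
      using hk(3) z unfolding holomorphic2_on_def by blast
    have "(d has_derivative (\<lambda>h. (a - a') * fst h + (b - b') * snd h)) (at z)"
      unfolding d_def[abs_def]
      by (rule has_derivative_eq_rhs[OF has_derivative_diff[OF 1 2]]) (auto simp: algebra_simps)
    then show "\<exists>a b. (d has_derivative (\<lambda>h. a * fst h + b * snd h)) (at z)" by blast
  qed
  moreover have dL: "d \<in> L2 \<Omega>" unfolding d_def[abs_def] by (rule L2_diff[OF hk(2,1)])
  ultimately have db: "d \<in> bergman_space \<Omega>" and contd: "continuous_on \<Omega> d"
    by (auto simp: bergman_space_def holomorphic2_on_continuous_on)
  have i: "integrable (lebesgue_on \<Omega>) (\<lambda>z. (f z - h z) * cnj (d z))"
    "integrable (lebesgue_on \<Omega>) (\<lambda>z. (f z - k z) * cnj (d z))"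
    by (intro L2_mult_integrable L2_diff L2_cnj f hk dL)+
  have "(LINT z|lebesgue_on \<Omega>. (f z - h z) * cnj (d z) - (f z - k z) * cnj (d z)) = 0"
    using i orth[OF db] k db by (simp add: L2_inner_def)
  also have "(\<lambda>z. (f z - h z) * cnj (d z) - (f z - k z) * cnj (d z)) = (\<lambda>z. complex_of_real ((cmod (d z))\<^sup>2))"
    unfolding complex_norm_square by (auto simp: d_def algebra_simps)
  finally have "(LINT z|lebesgue_on \<Omega>. (cmod (d z))\<^sup>2) = 0"
    by (simp only: integral_complex_of_real of_real_eq_0_iff)
  then have "AE z in lebesgue_on \<Omega>. (cmod (d z))\<^sup>2 = 0"
    using dL by (subst (asm) integral_nonneg_eq_0_iff_AE) (auto simp: L2_def)
  then have ae: "AE z in lebesgue. z \<in> \<Omega> \<longrightarrow> d z = 0"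
    using \<Omega> by (subst (asm) AE_restrict_space_iff) auto
  define U where "U = {z \<in> \<Omega>. d z \<noteq> 0}"
  have "open U"
    using continuous_open_preimage[OF contd \<Omega> open_Compl[OF closed_singleton[of 0]]] by (simp add: U_def vimage_def Int_def)
  moreover have "negligible U"
    unfolding negligible_iff_null_sets
    using ae \<open>open U\<close> by (subst AE_iff_null_sets) (auto simp: U_def elim!: eventually_mono)
  ultimately have "U = {}" using open_not_negligible by blast
  then show "k = h"
    using h(2) k by (fastforce simp: U_def d_def fun_eq_iff)
qed

section \<open>A smooth function projecting to the derivative of the conformal map\<close>

lemma polydisc_inter_lens: "polydisc_inter = lens \<times> ball 0 1"
  by (auto simp: polydisc_inter_eq lens_def)

lemma smooth_on_UNIV_imp_smooth_upto_closure:
  assumes "smooth_on UNIV f"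
  shows "f \<in> smooth_upto_closure \<Omega>"
proof -
  have "continuous_on (closure \<Omega>) (iter_partial bs f)" if "bs \<in> lists Basis" for bs
    using smooth_on_imp_continuous_on[OF smooth_on_iter_partial[OF assms that]]
    by (rule continuous_on_subset) simp
  moreover have "smooth_on \<Omega> f" using assms by (auto simp: smooth_on_def)
  ultimately show ?thesis by (auto simp: smooth_upto_closure_def)
qed

text \<open>By properness the sublevel set \<open>K\<close> is compact, so the lens and the
  complement of \<open>K\<close> are open sets covering the plane; the function is smooth over the
  first and zero over the second. It is constant in the second variable, so its compact support
  concerns the first variable only.\<close>

lemma lens_map_radial_smooth:
  assumes \<eta>: "\<And>n. times_differentiable_on n UNIV \<eta>" and \<eta>0: "\<And>s. s \<ge> c \<Longrightarrow> \<eta> s = 0" and c: "c < 1"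
  shows "smooth_on UNIV (\<lambda>z::complex \<times> complex. if fst z \<in> lens
    then of_real (\<eta> ((cmod (lens_map (fst z)))\<^sup>2)) * lens_map' (fst z) else 0)" (is "smooth_on UNIV ?f")
proof (rule smooth_onI)
  fix n
  define K where "K = {x \<in> lens. (cmod (lens_map x))\<^sup>2 \<le> c}"
  have K: "compact K" unfolding K_def by (rule lens_map_proper[OF c])
  have op: "open (lens \<times> (UNIV :: complex set))" "open ((- K) \<times> (UNIV :: complex set))"
    using lens_open K by (auto intro!: open_Times compact_imp_closed)
  have hol: "times_differentiable_on n (lens \<times> (UNIV :: complex set)) (\<lambda>z. G (fst z))" if "G holomorphic_on lens" for G
    using that by (rule times_differentiable_on_holomorphic[OF lens_open])
  have re: "times_differentiable_on n (lens \<times> (UNIV::complex set)) (\<lambda>z. (cmod (lens_map (fst z)))\<^sup>2)"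
  proof -
    have "times_differentiable_on n (lens \<times> (UNIV::complex set))
        (\<lambda>z. Re (lens_map (fst z)) * Re (lens_map (fst z)) + Im (lens_map (fst z)) * Im (lens_map (fst z)))"
      by (intro times_differentiable_on_add times_differentiable_on_bilinear[OF bounded_bilinear_mult]
          times_differentiable_on_compose_linear[OF bounded_linear_Re]
          times_differentiable_on_compose_linear[OF bounded_linear_Im] hol lens_map_holomorphic)
    then show ?thesis unfolding cmod_power2 by (simp add: power2_eq_square)
  qed
  have "times_differentiable_on n (lens \<times> (UNIV::complex set))
      (\<lambda>z. of_real (\<eta> ((cmod (lens_map (fst z)))\<^sup>2)) * lens_map' (fst z))"
    by (intro times_differentiable_on_bilinear[OF bounded_bilinear_mult] hol lens_map'_holomorphic
        times_differentiable_on_compose_linear[OF bounded_linear_of_real]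
        times_differentiable_on_compose_real[OF \<eta> re]) auto
  then have 1: "times_differentiable_on n (lens \<times> UNIV) ?f"
    by (rule times_differentiable_on_cong[OF op(1), rotated]) auto
  have 2: "times_differentiable_on n ((- K) \<times> UNIV) ?f"
  proof (rule times_differentiable_on_cong[OF op(2) _ times_differentiable_on_const[of _ _ 0]])
    show "0 = ?f z" if "z \<in> (- K) \<times> UNIV" for z
      using that \<eta>0[of "(cmod (lens_map (fst z)))\<^sup>2"] linear[of c "(cmod (lens_map (fst z)))\<^sup>2"]
      by (auto simp: K_def)
  qed
  have "(lens \<times> UNIV) \<union> ((- K) \<times> UNIV) = (UNIV :: (complex \<times> complex) set)"
    by (auto simp: K_def)
  then show "times_differentiable_on n UNIV ?f"
    using times_differentiable_on_union[OF 1 2 op] by simp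
qed auto

lemma lens_map'_bergman_projection:
  fixes \<Omega> :: "(complex \<times> complex) set"
  defines "\<Omega> \<equiv> lens \<times> ball 0 1"
  obtains f where "smooth_on UNIV f"
    "bergman_projection \<Omega> f = (\<lambda>z. if z \<in> \<Omega> then lens_map' (fst z) else 0)"
proof -
  obtain \<rho> \<rho>' where \<rho>: "\<And>n. times_differentiable_on n UNIV \<rho>" "\<And>n. times_differentiable_on n UNIV \<rho>'"
    "\<And>x. (\<rho> has_real_derivative \<rho>' x) (at x)"
    "\<And>x. x \<le> 1 \<Longrightarrow> \<rho> x = 0" "\<And>x. x \<ge> 2 \<Longrightarrow> \<rho> x = 1"
    "\<And>x. x \<le> 1 \<Longrightarrow> \<rho>' x = 0" "\<And>x. x \<ge> 2 \<Longrightarrow> \<rho>' x = 0"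
    by (rule smooth_step_exists) metis
  have \<Omega>: "open \<Omega>" "bounded \<Omega>"
    using lens_open lens_bounded by (auto simp: \<Omega>_def open_Times bounded_Times)
  \<comment> \<open>As s grows, the argument 3 - 4s passes 2 at s = 1/4 and 1 at s = 1/2:
    \<open>X\<close> is 0 up to 1/4 and equals 1 - s from 1/2 on, where \<open>\<eta>\<close> = 1 +
    X' vanishes.\<close>
  define X where "X s = (1 - s) * (1 - \<rho> (3 + - 4 * s))" for s
  define \<eta> where "\<eta> s = \<rho> (3 + - 4 * s) + (4 + - 4 * s) * \<rho>' (3 + - 4 * s)" for s
  define X' where "X' s = \<eta> s - 1" for s
  have dX: "(X has_real_derivative X' s) (at s)" for s
  proof -
    have r: "((\<lambda>s. \<rho> (3 + - 4 * s)) has_real_derivative \<rho>' (3 + - 4 * s) * - 4) (at s)"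
      by (rule DERIV_chain2[OF \<rho>(3)]) (auto intro!: derivative_eq_intros)
    show ?thesis
      unfolding X_def[abs_def] X'_def \<eta>_def
      by (rule DERIV_cong[OF DERIV_mult[OF DERIV_diff[OF DERIV_const DERIV_ident]
              DERIV_diff[OF DERIV_const r]]])
        (simp add: algebra_simps)
  qed
  have td\<eta>: "times_differentiable_on n UNIV \<eta>" for n
  proof -
    have lin: "times_differentiable_on n UNIV (\<lambda>s::real. a + - 4 * s)" for a
      by (intro times_differentiable_on_add times_differentiable_on_const
          times_differentiable_on_bounded_linear bounded_linear_mult_right)
    show ?thesis
      unfolding \<eta>_def[abs_def]
      by (intro times_differentiable_on_add[OF times_differentiable_on_compose_real[OF \<rho>(1) lin]]
          times_differentiable_on_bilinear[OF bounded_bilinear_mult lin]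
          times_differentiable_on_compose_real[OF \<rho>(2) lin]) auto
  qed
  have \<eta>0: "\<eta> s = 0" if "s \<ge> 1/2" for s using that by (simp add: \<eta>_def \<rho>)
  have "continuous_on UNIV \<eta>"
    by (auto intro!: continuous_at_imp_continuous_on differentiable_imp_continuous_within
        times_differentiable_on_imp_differentiable[OF td\<eta>])
  then have contX': "continuous_on UNIV X'" unfolding X'_def[abs_def] by (intro continuous_intros)
  define N where "N x = (cmod (lens_map x))\<^sup>2" for x
  define f where "f z = (if fst z \<in> lens then of_real (\<eta> (N (fst z))) * lens_map' (fst z) else 0)"
    for z :: "complex \<times> complex"
  define h where "h z = (if z \<in> \<Omega> then lens_map' (fst z) else 0)" for z
  have smooth: "smooth_on UNIV f"
    unfolding f_def[abs_def] N_def by (rule lens_map_radial_smooth[OF td\<eta> \<eta>0, of "1/2"]) auto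
  have fL: "f \<in> L2 \<Omega>"
    using smooth_on_UNIV_imp_smooth_upto_closure[OF smooth]
      smooth_upto_closure_subset_sobolev[OF \<Omega>, of 0] sobolev_0 by blast
  obtain B where B: "\<And>z. z \<in> lens \<Longrightarrow> cmod (lens_map' z) \<le> B"
    by (rule lens_map'_bounded) blast
  have dh: "(h has_derivative (\<lambda>h. deriv lens_map' (fst z) * fst h + 0 * snd h)) (at z)" if z: "z \<in> \<Omega>" for z
  proof -
    have "(lens_map' has_derivative (*) (deriv lens_map' (fst z))) (at (fst z))"
      using holomorphic_derivI[OF lens_map'_holomorphic lens_open] z
      by (auto simp: \<Omega>_def has_field_derivative_def)
    from has_derivative_compose[OF has_derivative_fst[OF has_derivative_ident] this]
    have "((\<lambda>z. lens_map' (fst z)) has_derivative (\<lambda>h. deriv lens_map' (fst z) * fst h + 0 * snd h)) (at z)"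
      by simp
    then show ?thesis
      by (rule has_derivative_transform_within_open[OF _ \<Omega>(1) z]) (simp add: h_def)
  qed
  have hh: "holomorphic2_on h \<Omega>" unfolding holomorphic2_on_def using dh by blast
  have "h \<in> L2 \<Omega>"
    by (rule bounded_continuous_L2[OF \<Omega> holomorphic2_on_continuous_on[OF hh], of B])
      (use B in \<open>auto simp: h_def \<Omega>_def\<close>)
  then have hb: "h \<in> bergman_space \<Omega>" using hh by (simp add: bergman_space_def)
  have "bergman_projection \<Omega> f = h"
  proof (rule bergman_projection_eqI[OF \<Omega>(1) fL hb])
    show "h z = 0" if "z \<notin> \<Omega>" for z using that by (simp add: h_def)
    fix g assume g: "g \<in> bergman_space \<Omega>"
    have "(LINT z|lebesgue_on \<Omega>. of_real (X' (N (fst z))) * cnj (deriv lens_map (fst z)) * g z) = 0"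
      unfolding \<Omega>_def N_def
    proof (rule radial_orthogonality[OF lens_open lens_bounded lens_map_holomorphic lens_map_bound
          lens_map_proper _ dX contX' _ _ _ g[unfolded \<Omega>_def]])
      show "cmod (deriv lens_map x) \<le> B" if "x \<in> lens" for x
        using B[OF that] deriv_lens_map[OF that] by simp
    qed (auto simp: X_def X'_def \<eta>_def \<rho>)
    \<comment> \<open>\<open>L2_inner\<close> conjugates its second argument, whereas the
      orthogonality relation has the conjugate on \<open>deriv lens_map\<close>; on \<Omega> the
      difference f - h is X'(N) times that derivative.\<close>
    then have "cnj (LINT z|lebesgue_on \<Omega>. of_real (X' (N (fst z))) * cnj (deriv lens_map (fst z)) * g z) = 0"
      by simp
    also have "cnj (LINT z|lebesgue_on \<Omega>. of_real (X' (N (fst z))) * cnj (deriv lens_map (fst z)) * g z) =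
      (LINT z|lebesgue_on \<Omega>. cnj (of_real (X' (N (fst z))) * cnj (deriv lens_map (fst z)) * g z))"
      by (rule Bochner_Integration.integral_cnj[symmetric])
    also have "\<dots> = L2_inner \<Omega> (\<lambda>z. f z - h z) g"
      unfolding L2_inner_def
      by (rule Bochner_Integration.integral_cong)
        (auto simp: f_def h_def X'_def \<Omega>_def deriv_lens_map algebra_simps)
    finally show "L2_inner \<Omega> (\<lambda>z. f z - h z) g = 0" .
  qed
  then show ?thesis using that[OF smooth] unfolding h_def[abs_def] by blast
qed

text \<open>On the ball of radius e s^2 about (corner - i s^2, 0) the squared derivative is at least
  of order s^(-10), while the volume in real dimension 4 is of order s^8. A weak derivative in L2
  would have a finite square integral exceeding a fixed multiple of s^(-2) for all small s.\<close>

lemma lens_map'_not_sobolev: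
  fixes \<Omega> :: "(complex \<times> complex) set"
  defines "\<Omega> \<equiv> lens \<times> ball 0 1"
  shows "(\<lambda>z. if z \<in> \<Omega> then lens_map' (fst z) else 0) \<notin> sobolev 3 \<Omega>" (is "?h \<notin> _")
proof
  assume sob: "?h \<in> sobolev 3 \<Omega>"
  define bs where "bs = replicate 3 (1 :: complex, 0 :: complex)"
  have bs: "bs \<in> lists Basis" "length bs = 3"
    by (auto simp: bs_def Basis_prod_def Basis_complex_def)
  obtain g where g: "g \<in> L2 \<Omega>" "weak_derivative \<Omega> bs ?h g"
  proof -
    have "\<forall>bs \<in> lists Basis. length bs \<le> 3 \<longrightarrow> (\<exists>g\<in>L2 \<Omega>. weak_derivative \<Omega> bs ?h g)"
      using sob by (simp add: sobolev_def)
    from bspec[OF this bs(1)] bs(2) show ?thesis using that by auto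
  qed
  have \<Omega>: "open \<Omega>" using lens_open by (simp add: \<Omega>_def open_Times)
  have "times_differentiable_on n \<Omega> (\<lambda>z. lens_map' (fst z))" for n
    by (rule times_differentiable_on_subset[OF
          times_differentiable_on_holomorphic[OF lens_open lens_map'_holomorphic]])
      (auto simp: \<Omega>_def)
  then have smooth: "smooth_on \<Omega> ?h"
    by (intro smooth_onI[OF \<Omega>] times_differentiable_on_cong[OF \<Omega>, where g = ?h]) auto
  define D where "D = iter_partial bs ?h"
  have contD: "continuous_on \<Omega> D"
    unfolding D_def by (rule smooth_on_imp_continuous_on[OF smooth_on_iter_partial[OF smooth bs(1)]])
  have D: "D z = (deriv ^^ 3) lens_map' (fst z)" if "z \<in> \<Omega>" for z
    unfolding D_def bs_def using that
    by (intro iter_partial_holomorphic_fst[OF lens_open open_ball lens_map'_holomorphic])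
      (auto simp: \<Omega>_def)
  have "rev bs = bs" by (simp add: bs_def)
  then have hD: "weak_derivative \<Omega> bs ?h D"
    using weak_derivative_smooth[OF \<Omega> smooth bs(1)] by (simp add: D_def)
  have eq: "(LINT x|lebesgue_on \<Omega>. \<phi> x *\<^sub>R g x) = (LINT x|lebesgue_on \<Omega>. \<phi> x *\<^sub>R D x)"
    if "\<phi> \<in> test_functions \<Omega>" for \<phi>
    using bspec[OF g(2)[unfolded weak_derivative_def] that]
      bspec[OF hD[unfolded weak_derivative_def] that] by simp
  obtain u c e where u: "cmod u = 1" and c: "0 < c" and e: "0 < e" "e \<le> 1/4"
    and blow: "\<And>s x. 0 < s \<Longrightarrow> s < e \<Longrightarrow> dist (corner - \<i> * (of_real s)\<^sup>2) x \<le> e * s\<^sup>2 \<Longrightarrow>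
      x \<in> lens \<and> c / s ^ 5 \<le> Re (u * (deriv ^^ 3) lens_map' x)"
    by (rule third_deriv_blowup) blast
  define Q where "Q = (LINT x|lebesgue_on \<Omega>. (cmod (g x))\<^sup>2)"
  \<comment> \<open>The constant left when (c / s^5)^2 is multiplied by the volume of the 4-ball of
    radius e s^2 / 2 and the powers of s are collected into s^(-2).\<close>
  define v where "v = unit_ball_vol 4 * (e/2) ^ 4 * c\<^sup>2"
  have v: "0 < v" using c e by (simp add: v_def)
  have lower: "v \<le> Q * s\<^sup>2" if s: "0 < s" "s < e" for s
  proof -
    define p where "p = (corner - \<i> * (of_real s)\<^sup>2, 0 :: complex)"
    have r: "0 < e * s\<^sup>2" using s e by simp
    have "s\<^sup>2 < 1" using s e by (simp add: power_less_one_iff)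
    then have r1: "e * s\<^sup>2 < 1" using e mult_strict_mono[of e 1 "s\<^sup>2" 1] s by simp
    have ball: "fst x \<in> lens \<and> c / s ^ 5 \<le> Re (u * (deriv ^^ 3) lens_map' (fst x)) \<and> cmod (snd x) < 1"
      if x: "x \<in> cball p (e * s\<^sup>2)" for x
    proof -
      have "dist (fst p) (fst x) \<le> e * s\<^sup>2" "dist (snd p) (snd x) \<le> e * s\<^sup>2"
        using x dist_fst_le[of p x] dist_snd_le[of p x] by auto
      then show ?thesis
        using blow[OF s, of "fst x"] r1 by (auto simp: p_def)
    qed
    have "(c / s ^ 5)\<^sup>2 * measure lborel (ball p (e * s\<^sup>2 / 2)) \<le> Q"
      unfolding Q_def
    proof (rule weak_derivative_L2_lower_bound[OF \<Omega> g(1) contD eq r _ u])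
      show "cball p (e * s\<^sup>2) \<subseteq> \<Omega>"
        using ball by (auto simp: \<Omega>_def mem_Times_iff simp del: mem_cball)
      then show "c / s ^ 5 \<le> Re (u * D x)" if "x \<in> cball p (e * s\<^sup>2)" for x
        using ball[OF that] D[of x] that by auto
    qed (use c s in auto)
    also have "measure lborel (ball p (e * s\<^sup>2 / 2)) = unit_ball_vol 4 * (e * s\<^sup>2 / 2) ^ 4"
      using r by (simp add: content_ball)
    also have "(c / s ^ 5)\<^sup>2 * (unit_ball_vol 4 * (e * s\<^sup>2 / 2) ^ 4) = v / s\<^sup>2"
    proof -
      have cancel: "(x / (t * y)) * (z * (w * t)) = z * w * x / y" if "t \<noteq> 0" for t w x y z :: real
        using that by simp
      have "(c / s ^ 5)\<^sup>2 * (unit_ball_vol 4 * (e * s\<^sup>2 / 2) ^ 4) =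
          (c\<^sup>2 / (s ^ 8 * s\<^sup>2)) * (unit_ball_vol 4 * ((e / 2) ^ 4 * s ^ 8))"
        by (simp add: power_divide power_mult_distrib flip: power_mult power_add)
      also have "\<dots> = v / s\<^sup>2"
        unfolding v_def by (rule cancel) (use s in simp)
      finally show ?thesis .
    qed
    finally show ?thesis using s by (simp add: divide_le_eq)
  qed
  \<comment> \<open>Small enough that Q s^2 \<le> |Q| s < v, against \<open>lower\<close>; the added
    1 keeps the denominator positive.\<close>
  define s where "s = min (e/2) (v / (\<bar>Q\<bar> + 1))"
  have s: "0 < s" "s < e" "s \<le> v / (\<bar>Q\<bar> + 1)" using e v by (auto simp: s_def)
  have "Q * s\<^sup>2 \<le> \<bar>Q\<bar> * s"
  proof (rule mult_mono)
    show "s\<^sup>2 \<le> s" using s e by (simp add: power2_eq_square mult_left_le)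
  qed (use s in auto)
  also have "\<dots> < (\<bar>Q\<bar> + 1) * s" using s by simp
  also have "\<dots> \<le> v" using s(3) by (simp add: le_divide_eq mult.commute)
  finally show False using lower[OF s(1,2)] by simp
qed

theorem theorem1:
  shows "\<not> exactly_regular polydisc_inter \<and>
    (\<exists>f \<in> smooth_upto_closure polydisc_inter.
       bergman_projection polydisc_inter f \<notin> smooth_upto_closure polydisc_inter \<and>
       (\<exists>K. \<forall>k \<ge> K. bergman_projection polydisc_inter f \<notin> sobolev k polydisc_inter))"
proof -
  let ?\<Omega> = polydisc_inter
  have \<Omega>: "open ?\<Omega>" "bounded ?\<Omega>"
    using lens_open lens_bounded by (auto simp: polydisc_inter_lens open_Times bounded_Times)
  note sub = smooth_upto_closure_subset_sobolev[OF \<Omega>]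
  obtain f where f: "smooth_on UNIV f"
    "bergman_projection ?\<Omega> f = (\<lambda>z. if z \<in> ?\<Omega> then lens_map' (fst z) else 0)"
    by (rule lens_map'_bergman_projection) (use that in \<open>simp add: polydisc_inter_lens\<close>)
  have fs: "f \<in> smooth_upto_closure ?\<Omega>"
    by (rule smooth_on_UNIV_imp_smooth_upto_closure[OF f(1)])
  \<comment> \<open>All the assertions reduce to this one: \<open>f\<close> lies in every Sobolev
    space, the spaces decrease with the order, and they contain the functions smooth up to the
    closure.\<close>
  have not3: "bergman_projection ?\<Omega> f \<notin> sobolev 3 ?\<Omega>"
    using lens_map'_not_sobolev f(2) unfolding polydisc_inter_lens by simp
  have "\<not> exactly_regular ?\<Omega>"
    using not3 fs sub[of 3] unfolding exactly_regular_def by blast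
  moreover have "bergman_projection ?\<Omega> f \<notin> smooth_upto_closure ?\<Omega>"
    using not3 sub[of 3] by blast
  moreover have "bergman_projection ?\<Omega> f \<notin> sobolev k ?\<Omega>" if "3 \<le> k" for k
    using not3 sobolev_antimono[OF that] by blast
  ultimately show ?thesis using fs by blast
qed

end
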